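(* Let $n\geq 1$, let $H$ be an abelian subgroup of the symmetric group $\operatorname{Sym}_n$, and let $K$ be a field. Then the Jacobson radical of the algebra $K[S_n(H)]$ is zero: $J(K[S_n(H)])=\{0\}$.
   Context: For a subset $H\subseteq \operatorname{Sym}_n$, $S_n(H)$ denotes the monoid with presentation $\langle a_1,\dots,a_n \mid a_1a_2\cdots a_n = a_{\sigma(1)}a_{\sigma(2)}\cdots a_{\sigma(n)},\ \sigma\in H\rangle$, and $K[S_n(H)]$ is its monoid algebra over $K$, i.e. the algebra $K\langle a_1,\dots,a_n\mid a_1\cdots a_n=a_{\sigma(1)}\cdots a_{\sigma(n)},\ \sigma\in H\rangle$. *)

theory Defs
  imports "HOL-Algebra.Sym_Groups" "HOL-Algebra.Ideal"
begin

text \<open>Generators a_1,...,a_n are encoded as the natural numbers 1..n; words are lists.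
  The base word is a_1 a_2 ... a_n = [1..<n+1]; for a permutation s of {1..n}
  the permuted word a_s(1) ... a_s(n) is map s [1..<n+1].\<close>

definition base_word :: "nat \<Rightarrow> nat list" where
  "base_word n = [1..<Suc n]"

inductive sn_eq :: "nat \<Rightarrow> (nat \<Rightarrow> nat) set \<Rightarrow> nat list \<Rightarrow> nat list \<Rightarrow> bool"
  for n :: nat and H :: "(nat \<Rightarrow> nat) set" where
  rel: "s \<in> H \<Longrightarrow> sn_eq n H (u @ base_word n @ v) (u @ map s (base_word n) @ v)"
| refl: "sn_eq n H w w"
| sym: "sn_eq n H u v \<Longrightarrow> sn_eq n H v u"
| trans: "sn_eq n H u v \<Longrightarrow> sn_eq n H v w \<Longrightarrow> sn_eq n H u w"

definition sn_class :: "nat \<Rightarrow> (nat \<Rightarrow> nat) set \<Rightarrow> nat list \<Rightarrow> nat list set" where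
  "sn_class n H w = {v. sn_eq n H w v}"

definition sn_monoid :: "nat \<Rightarrow> (nat \<Rightarrow> nat) set \<Rightarrow> nat list set set" where
  "sn_monoid n H = sn_class n H ` {w. set w \<subseteq> {1..n}}"

definition sn_mult :: "nat \<Rightarrow> (nat \<Rightarrow> nat) set \<Rightarrow> nat list set \<Rightarrow> nat list set \<Rightarrow> nat list set" where
  "sn_mult n H c d = {w. \<exists>u\<in>c. \<exists>v\<in>d. sn_eq n H (u @ v) w}"

definition fsupp :: "('c \<Rightarrow> 'k::zero) \<Rightarrow> 'c set" where
  "fsupp f = {c. f c \<noteq> 0}"

definition sn_algebra :: "nat \<Rightarrow> (nat \<Rightarrow> nat) set \<Rightarrow> (nat list set \<Rightarrow> 'k::field) ring" where
  "sn_algebra n H = \<lparr>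
     carrier = {f. finite (fsupp f) \<and> fsupp f \<subseteq> sn_monoid n H},
     mult = (\<lambda>f g c. \<Sum>p\<in>{(c1, c2). c1 \<in> fsupp f \<and> c2 \<in> fsupp g \<and> sn_mult n H c1 c2 = c}.
                         f (fst p) * g (snd p)),
     one = (\<lambda>c. if c = sn_class n H [] then 1 else 0),
     zero = (\<lambda>c. 0),
     add = (\<lambda>f g c. f c + g c) \<rparr>"

definition left_ideal :: "'a set \<Rightarrow> ('a, 'b) ring_scheme \<Rightarrow> bool" where
  "left_ideal I R \<longleftrightarrow> additive_subgroup I R \<and>
     (\<forall>r\<in>carrier R. \<forall>x\<in>I. r \<otimes>\<^bsub>R\<^esub> x \<in> I)"

definition maximal_left_ideal :: "'a set \<Rightarrow> ('a, 'b) ring_scheme \<Rightarrow> bool" where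
  "maximal_left_ideal I R \<longleftrightarrow> left_ideal I R \<and> I \<noteq> carrier R \<and>
     (\<forall>J. left_ideal J R \<and> I \<subseteq> J \<and> J \<noteq> carrier R \<longrightarrow> J = I)"

definition jacobson_radical :: "('a, 'b) ring_scheme \<Rightarrow> 'a set" where
  "jacobson_radical R = carrier R \<inter> \<Inter>{I. maximal_left_ideal I R}"

end

theory Submission
  imports Defs
begin

text \<open>
  Every element g of the radical J admits u with u(1 - g) = 1. Take g = Qf with f in J and Q a
  homogeneous sum of words of positive length: the top homogeneous component of uQf must vanish.
  Hence J = 0 as soon as Q is chosen such that for homogeneous sets T and F of elements of the
  monoid some product tqf is attained only once.

  If H is not transitive, let x be outside the orbit of 1 and y outside the orbit of n; no relator
  overlaps yyxx, so Q = yyxx works. If H is transitive, it is regular, being abelian. Adding a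
  letter z for the common value of all relators gives, by commutativity of H, a complete rewriting
  system: relators become z, and z moves to the left past the overlaps. The number of letters z never
  decreases under reduction. For normal forms t and f with the fewest letters z, there are x and y
  in {1,2} with tx and yf irreducible (or, if z is central, y followed by the part of f without z),
  and then txxyyyf is irreducible; this makes Q = (11 + 22)(111 + 222) work. For n = 2 the transitive
  case is commutative.
\<close>

section \<open>Quasi-regularity of the Jacobson radical\<close>

text \<open>A separator that no relator overlaps requires a letter that starts no relator and one
  that ends none. Under a transitive group every letter does both, so only the seams can be
  controlled. Since the letters of a relator are distinct, a doubled letter blocks every rule. A
  relator completed by appending x to a normal form t is determined by its first letter, by
  regularity, so at most one letter x is bad; prepending y is similar. Hence two letters suffice,
  but Q must be fixed before t and f are known, so it sums over all choices of x and y. The third y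
  is a spare: if y'f' reduces in a competing product, y'y' still stands as a barrier.

  Commutativity gives confluence: with letters identified with group elements, passing from a
  relator to one overlapping it at a given distance is multiplication by a group element, and two
  such passages commute.

  Minimality of the number of z rules out contractions in competitors, as each adds a z. The
  remaining danger is a rule moving z past a single letter. It exists only if rotating a relator by
  one letter gives a relator, and then z is central: hence the split of the transitive case.\<close>

context ring begin

lemma left_ideal_one_imp_carrier:
  assumes "left_ideal I R" "\<one> \<in> I"
  shows "I = carrier R"
proof
  show "I \<subseteq> carrier R"
    using assms unfolding left_ideal_def by (blast dest: additive_subgroup.a_subset)
  show "carrier R \<subseteq> I"
    using assms unfolding left_ideal_def by (metis r_one subsetI)
qed

lemma left_ideal_Union_chain:
  assumes "C \<noteq> {}" and chain: "subset.chain {J. left_ideal J R} C"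
  shows "left_ideal (\<Union>C) R"
proof -
  have L: "left_ideal J R" "subgroup J (add_monoid R)" if "J \<in> C" for J
    using chain that
    by (auto simp: subset.chain_def left_ideal_def additive_subgroup_def)
  have "subgroup (\<Union>C) (add_monoid R)"
  proof (rule subgroup.intro)
    fix x y assume "x \<in> \<Union>C" "y \<in> \<Union>C"
    then obtain J where "J \<in> C" "x \<in> J" "y \<in> J"
      using chain unfolding subset.chain_def by blast
    then show "x \<otimes>\<^bsub>add_monoid R\<^esub> y \<in> \<Union>C"
      using subgroup.m_closed[OF L(2)] by blast
  next
    fix x assume "x \<in> \<Union>C"
    then show "inv\<^bsub>add_monoid R\<^esub> x \<in> \<Union>C"
      using subgroup.m_inv_closed[OF L(2)] by blast
  next
    show "\<Union>C \<subseteq> carrier (add_monoid R)"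
      using subgroup.subset[OF L(2)] by blast
    show "\<one>\<^bsub>add_monoid R\<^esub> \<in> \<Union>C"
      using assms(1) subgroup.one_closed[OF L(2)] by blast
  qed
  then show ?thesis
    using L(1) unfolding left_ideal_def additive_subgroup_def by blast
qed

text \<open>Zorn's lemma applies because a left ideal is proper exactly when it misses
  \<open>\<one>\<close>, and the union of a chain of such ideals still misses it.\<close>

lemma left_ideal_subset_maximal:
  assumes "left_ideal I R" "\<one> \<notin> I"
  shows "\<exists>M. maximal_left_ideal M R \<and> I \<subseteq> M"
proof -
  let ?A = "{J. left_ideal J R \<and> I \<subseteq> J \<and> \<one> \<notin> J}"
  have "\<exists>M\<in>?A. \<forall>X\<in>?A. M \<subseteq> X \<longrightarrow> X = M"
  proof (rule subset_Zorn_nonempty)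
    show "?A \<noteq> {}" using assms by blast
    fix C assume C: "C \<noteq> {}" "subset.chain ?A C"
    then have "subset.chain {J. left_ideal J R} C"
      unfolding subset.chain_def by blast
    with C(1) have "left_ideal (\<Union>C) R" by (rule left_ideal_Union_chain)
    then show "\<Union>C \<in> ?A" using C unfolding subset.chain_def by blast
  qed
  then obtain M where M: "M \<in> ?A" and max: "\<forall>X\<in>?A. M \<subseteq> X \<longrightarrow> X = M"
    by (elim bexE)
  have "maximal_left_ideal M R"
    unfolding maximal_left_ideal_def
  proof (intro conjI allI impI)
    fix J assume "left_ideal J R \<and> M \<subseteq> J \<and> J \<noteq> carrier R"
    moreover from this have "\<one> \<notin> J" using left_ideal_one_imp_carrier by blast
    ultimately show "J = M" using M max by auto
  qed (use M(1) in auto)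
  then show ?thesis using M(1) by blast
qed

lemma left_ideal_principal:
  assumes "e \<in> carrier R"
  shows "left_ideal ((\<lambda>r. r \<otimes> e) ` carrier R) R"
  unfolding left_ideal_def
proof (intro conjI ballI)
  show "additive_subgroup ((\<lambda>r. r \<otimes> e) ` carrier R) R"
  proof (unfold_locales, goal_cases)
    case (2 x y)
    then show ?case using assms by (auto simp: l_distr[symmetric] intro!: imageI)
  next
    case 3
    have "\<zero> = \<zero> \<otimes> e" using assms by simp
    then show ?case by auto
  next
    case (4 x)
    then obtain r where r: "r \<in> carrier R" "x = r \<otimes> e" by auto
    have "\<ominus> x = (\<ominus> r) \<otimes> e" using r assms by (simp add: l_minus)
    then show ?case using r(1) by (auto simp: a_inv_def)
  qed (use assms in auto)
  fix r x assume "r \<in> carrier R" "x \<in> (\<lambda>r. r \<otimes> e) ` carrier R"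
  then show "r \<otimes> x \<in> (\<lambda>r. r \<otimes> e) ` carrier R"
    using assms by (auto simp: m_assoc[symmetric] intro!: imageI)
qed

lemma jacobson_radical_left_mult:
  assumes "a \<in> jacobson_radical R" "r \<in> carrier R"
  shows "r \<otimes> a \<in> jacobson_radical R"
  using assms unfolding jacobson_radical_def maximal_left_ideal_def left_ideal_def by auto

text \<open>Otherwise the left ideal generated by \<open>\<one> \<ominus> a\<close> lies in a
  maximal one, which also contains \<open>a\<close> and hence \<open>\<one>\<close>.\<close>

lemma jacobson_radical_left_inverse:
  assumes "a \<in> jacobson_radical R"
  shows "\<exists>u\<in>carrier R. u \<otimes> (\<one> \<ominus> a) = \<one>"
proof (rule ccontr)
  assume none: "\<not> ?thesis"
  have a: "a \<in> carrier R" using assms by (simp add: jacobson_radical_def)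
  let ?I = "(\<lambda>r. r \<otimes> (\<one> \<ominus> a)) ` carrier R"
  have "left_ideal ?I R" using a by (intro left_ideal_principal) simp
  moreover have "\<one> \<notin> ?I" using none by auto
  ultimately obtain M where M: "maximal_left_ideal M R" "?I \<subseteq> M"
    using left_ideal_subset_maximal by blast
  have "a \<in> M" using assms M(1) by (auto simp: jacobson_radical_def)
  moreover have "\<one> \<ominus> a \<in> M"
  proof -
    have "\<one> \<ominus> a = \<one> \<otimes> (\<one> \<ominus> a)" using a by simp
    then show ?thesis using M(2) by blast
  qed
  moreover have L: "left_ideal M R" "M \<noteq> carrier R"
    using M(1) by (auto simp: maximal_left_ideal_def)
  ultimately have "(\<one> \<ominus> a) \<oplus> a \<in> M"
    unfolding left_ideal_def by (auto intro: additive_subgroup.a_closed)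
  moreover have "(\<one> \<ominus> a) \<oplus> a = \<one>"
    using a by (simp add: minus_eq a_assoc l_neg)
  ultimately show False using L left_ideal_one_imp_carrier by auto
qed

lemma zero_in_jacobson_radical: "\<zero> \<in> jacobson_radical R"
  unfolding jacobson_radical_def maximal_left_ideal_def left_ideal_def
  by (auto intro: additive_subgroup.zero_closed)

end

section \<open>Monoid algebras\<close>

text \<open>Copies the shape of \<open>sn_algebra\<close> over an arbitrary monoid, so that
  identifying the two is mere unfolding and the ring axioms are proved without words.\<close>

definition monoid_algebra :: "('c, 'm) monoid_scheme \<Rightarrow> ('c \<Rightarrow> 'k::field) ring" where
  "monoid_algebra G = \<lparr>
     carrier = {f. finite (fsupp f) \<and> fsupp f \<subseteq> carrier G},
     mult = (\<lambda>f g c. \<Sum>p\<in>{(a, b). a \<in> fsupp f \<and> b \<in> fsupp g \<and> a \<otimes>\<^bsub>G\<^esub> b = c}.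
                         f (fst p) * g (snd p)),
     one = (\<lambda>c. if c = \<one>\<^bsub>G\<^esub> then 1 else 0),
     zero = (\<lambda>c. 0),
     add = (\<lambda>f g c. f c + g c) \<rparr>"

lemma monoid_algebra_carrier_iff:
  "f \<in> carrier (monoid_algebra G) \<longleftrightarrow> finite (fsupp f) \<and> fsupp f \<subseteq> carrier G"
  by (simp add: monoid_algebra_def)

lemma monoid_algebra_one: "\<one>\<^bsub>monoid_algebra G\<^esub> = (\<lambda>c. if c = \<one>\<^bsub>G\<^esub> then 1 else 0)"
  and monoid_algebra_zero: "\<zero>\<^bsub>monoid_algebra G\<^esub> = (\<lambda>c. 0)"
  and monoid_algebra_add: "f \<oplus>\<^bsub>monoid_algebra G\<^esub> g = (\<lambda>c. f c + g c)"
  by (simp_all add: monoid_algebra_def)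

text \<open>Arbitrary finite supersets of the supports serve as index sets, so that different
  functions can share one; the additional terms vanish.\<close>

lemma monoid_algebra_mult:
  assumes "finite A" "fsupp f \<subseteq> A" "finite B" "fsupp g \<subseteq> B"
  shows "(f \<otimes>\<^bsub>monoid_algebra G\<^esub> g) c =
    (\<Sum>a\<in>A. \<Sum>b\<in>B. if a \<otimes>\<^bsub>G\<^esub> b = c then f a * g b else 0)"
proof -
  have "(f \<otimes>\<^bsub>monoid_algebra G\<^esub> g) c =
    (\<Sum>p\<in>{(a, b). a \<in> fsupp f \<and> b \<in> fsupp g \<and> a \<otimes>\<^bsub>G\<^esub> b = c}. f (fst p) * g (snd p))"
    by (simp add: monoid_algebra_def)
  also have "\<dots> = (\<Sum>p\<in>A \<times> B. if fst p \<otimes>\<^bsub>G\<^esub> snd p = c then f (fst p) * g (snd p) else 0)"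
    by (rule sum.mono_neutral_cong_left) (use assms in \<open>auto simp: fsupp_def\<close>)
  also have "\<dots> = (\<Sum>a\<in>A. \<Sum>b\<in>B. if a \<otimes>\<^bsub>G\<^esub> b = c then f a * g b else 0)"
    by (simp add: sum.cartesian_product case_prod_unfold)
  finally show ?thesis .
qed

lemma monoid_algebra_fsupp_mult:
  "fsupp (f \<otimes>\<^bsub>monoid_algebra G\<^esub> g) \<subseteq> (\<lambda>(a, b). a \<otimes>\<^bsub>G\<^esub> b) ` (fsupp f \<times> fsupp g)"
proof
  fix c assume "c \<in> fsupp (f \<otimes>\<^bsub>monoid_algebra G\<^esub> g)"
  then have "(\<Sum>p\<in>{(a, b). a \<in> fsupp f \<and> b \<in> fsupp g \<and> a \<otimes>\<^bsub>G\<^esub> b = c}. f (fst p) * g (snd p)) \<noteq> 0"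
    by (simp add: fsupp_def monoid_algebra_def)
  then obtain p where "p \<in> {(a, b). a \<in> fsupp f \<and> b \<in> fsupp g \<and> a \<otimes>\<^bsub>G\<^esub> b = c}"
    by (rule sum.not_neutral_contains_not_neutral)
  then show "c \<in> (\<lambda>(a, b). a \<otimes>\<^bsub>G\<^esub> b) ` (fsupp f \<times> fsupp g)" by force
qed

lemma sum_rotate:
  "(\<Sum>p\<in>P. \<Sum>b\<in>B. \<Sum>c\<in>C. h p b c) = (\<Sum>b\<in>B. \<Sum>c\<in>C. \<Sum>p\<in>P. h p b c)"
proof -
  have "(\<Sum>p\<in>P. \<Sum>b\<in>B. \<Sum>c\<in>C. h p b c) = (\<Sum>b\<in>B. \<Sum>p\<in>P. \<Sum>c\<in>C. h p b c)"
    by (rule sum.swap)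
  also have "\<dots> = (\<Sum>b\<in>B. \<Sum>c\<in>C. \<Sum>p\<in>P. h p b c)"
    by (intro sum.cong[OF HOL.refl] sum.swap)
  finally show ?thesis .
qed

context monoid begin

lemma monoid_algebra_mult_closed:
  assumes "f \<in> carrier (monoid_algebra G)" "g \<in> carrier (monoid_algebra G)"
  shows "f \<otimes>\<^bsub>monoid_algebra G\<^esub> g \<in> carrier (monoid_algebra G)"
proof -
  let ?P = "(\<lambda>(a, b). a \<otimes> b) ` (fsupp f \<times> fsupp g)"
  have "finite ?P" "?P \<subseteq> carrier G"
    using assms by (auto simp: monoid_algebra_carrier_iff)
  then show ?thesis
    unfolding monoid_algebra_carrier_iff
    by (intro conjI finite_subset[OF monoid_algebra_fsupp_mult]
        subset_trans[OF monoid_algebra_fsupp_mult])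
qed

text \<open>Both bracketings reduce to one triple sum, which is associativity; the same formula
  later computes a coefficient of u(Qf).\<close>

lemma monoid_algebra_mult3:
  assumes f: "finite A" "A \<subseteq> carrier G" "fsupp f \<subseteq> A"
    and g: "finite B" "B \<subseteq> carrier G" "fsupp g \<subseteq> B"
    and h: "finite C" "C \<subseteq> carrier G" "fsupp h \<subseteq> C"
  shows "(f \<otimes>\<^bsub>monoid_algebra G\<^esub> (g \<otimes>\<^bsub>monoid_algebra G\<^esub> h)) x =
      (\<Sum>a\<in>A. \<Sum>b\<in>B. \<Sum>c\<in>C. if a \<otimes> (b \<otimes> c) = x then f a * (g b * h c) else 0)"
    and "((f \<otimes>\<^bsub>monoid_algebra G\<^esub> g) \<otimes>\<^bsub>monoid_algebra G\<^esub> h) x =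
      (\<Sum>a\<in>A. \<Sum>b\<in>B. \<Sum>c\<in>C. if a \<otimes> (b \<otimes> c) = x then f a * (g b * h c) else 0)"
proof -
  let ?R = "monoid_algebra G"
  define P where "P = (\<lambda>(b, c). b \<otimes> c) ` (B \<times> C)"
  have P: "finite P" "\<And>b c. b \<in> B \<Longrightarrow> c \<in> C \<Longrightarrow> b \<otimes> c \<in> P"
    using g h by (auto simp: P_def)
  have "fsupp (g \<otimes>\<^bsub>?R\<^esub> h) \<subseteq> P"
    unfolding P_def using g(3) h(3)
    by (intro subset_trans[OF monoid_algebra_fsupp_mult] image_mono Sigma_mono)
  note P = this P
  have "(f \<otimes>\<^bsub>?R\<^esub> (g \<otimes>\<^bsub>?R\<^esub> h)) x =
      (\<Sum>a\<in>A. \<Sum>p\<in>P. if a \<otimes> p = x then f a * (g \<otimes>\<^bsub>?R\<^esub> h) p else 0)"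
    using f(1,3) P by (intro monoid_algebra_mult)
  \<comment> \<open>The condition \<open>b \<otimes> c = p\<close> is kept as an indicator so that
    the sum over \<open>p\<close> can be moved inside, where exactly one \<open>p\<close> in
    \<open>P\<close> survives.\<close>
  also have "\<dots> = (\<Sum>a\<in>A. \<Sum>p\<in>P. \<Sum>b\<in>B. \<Sum>c\<in>C.
      if b \<otimes> c = p then (if a \<otimes> p = x then f a * (g b * h c) else 0) else 0)"
    using g(1,3) h(1,3)
    by (intro sum.cong HOL.refl)
      (auto simp: monoid_algebra_mult[of B g C h] sum_distrib_left intro!: sum.cong sum.neutral)
  also have "\<dots> = (\<Sum>a\<in>A. \<Sum>b\<in>B. \<Sum>c\<in>C. \<Sum>p\<in>P.
      if b \<otimes> c = p then (if a \<otimes> p = x then f a * (g b * h c) else 0) else 0)"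
    by (rule sum.cong[OF HOL.refl sum_rotate])
  also have "\<dots> = (\<Sum>a\<in>A. \<Sum>b\<in>B. \<Sum>c\<in>C. if a \<otimes> (b \<otimes> c) = x then f a * (g b * h c) else 0)"
    using P by (intro sum.cong HOL.refl) simp
  finally show "(f \<otimes>\<^bsub>?R\<^esub> (g \<otimes>\<^bsub>?R\<^esub> h)) x = \<dots>" .
  define P' where "P' = (\<lambda>(b, c). b \<otimes> c) ` (A \<times> B)"
  have P': "finite P'" "\<And>b c. b \<in> A \<Longrightarrow> c \<in> B \<Longrightarrow> b \<otimes> c \<in> P'"
    using g f by (auto simp: P'_def)
  have "fsupp (f \<otimes>\<^bsub>?R\<^esub> g) \<subseteq> P'"
    unfolding P'_def using f(3) g(3)
    by (intro subset_trans[OF monoid_algebra_fsupp_mult] image_mono Sigma_mono)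
  note P' = this P'
  have "((f \<otimes>\<^bsub>?R\<^esub> g) \<otimes>\<^bsub>?R\<^esub> h) x =
      (\<Sum>p\<in>P'. \<Sum>c\<in>C. if p \<otimes> c = x then (f \<otimes>\<^bsub>?R\<^esub> g) p * h c else 0)"
    using h(1,3) P' by (intro monoid_algebra_mult)
  also have "\<dots> = (\<Sum>p\<in>P'. \<Sum>c\<in>C. \<Sum>a\<in>A. \<Sum>b\<in>B.
      if a \<otimes> b = p then (if p \<otimes> c = x then f a * (g b * h c) else 0) else 0)"
    using f(1,3) g(1,3)
    by (intro sum.cong HOL.refl)
      (auto simp: monoid_algebra_mult[of A f B g] sum_distrib_right mult.assoc
        intro!: sum.cong sum.neutral)
  also have "\<dots> = (\<Sum>c\<in>C. \<Sum>a\<in>A. \<Sum>b\<in>B. \<Sum>p\<in>P'.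
      if a \<otimes> b = p then (if p \<otimes> c = x then f a * (g b * h c) else 0) else 0)"
    by (subst sum.swap) (rule sum.cong[OF HOL.refl sum_rotate])
  also have "\<dots> = (\<Sum>c\<in>C. \<Sum>a\<in>A. \<Sum>b\<in>B. if a \<otimes> (b \<otimes> c) = x then f a * (g b * h c) else 0)"
    using P' f g h by (intro sum.cong HOL.refl) (simp add: m_assoc subset_iff)
  also have "\<dots> = (\<Sum>a\<in>A. \<Sum>b\<in>B. \<Sum>c\<in>C. if a \<otimes> (b \<otimes> c) = x then f a * (g b * h c) else 0)"
    by (rule sum_rotate)
  finally show "((f \<otimes>\<^bsub>?R\<^esub> g) \<otimes>\<^bsub>?R\<^esub> h) x = \<dots>" .
qed

lemma monoid_algebra_ring: "ring (monoid_algebra G :: ('a \<Rightarrow> 'k::field) ring)" (is "ring ?R")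
proof (rule ringI)
  show "abelian_group ?R"
  proof (rule abelian_groupI)
    fix f g :: "'a \<Rightarrow> 'k" assume fg: "f \<in> carrier ?R" "g \<in> carrier ?R"
    have "fsupp (\<lambda>c. f c + g c) \<subseteq> fsupp f \<union> fsupp g" by (auto simp: fsupp_def)
    then show "f \<oplus>\<^bsub>?R\<^esub> g \<in> carrier ?R"
      using fg by (auto simp: monoid_algebra_carrier_iff monoid_algebra_add intro: finite_subset)
  next
    fix f :: "'a \<Rightarrow> 'k" assume "f \<in> carrier ?R"
    then have "(\<lambda>c. - f c) \<in> carrier ?R" by (simp add: monoid_algebra_carrier_iff fsupp_def)
    then show "\<exists>y\<in>carrier ?R. y \<oplus>\<^bsub>?R\<^esub> f = \<zero>\<^bsub>?R\<^esub>"
      by (rule bexI[rotated]) (simp add: monoid_algebra_add monoid_algebra_zero)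
  qed (auto simp: monoid_algebra_carrier_iff monoid_algebra_add monoid_algebra_zero fsupp_def
        add_ac)
  have one: "\<one>\<^bsub>?R\<^esub> \<in> carrier ?R" "fsupp (\<one>\<^bsub>?R\<^esub> :: 'a \<Rightarrow> 'k) \<subseteq> {\<one>}"
    by (auto simp: monoid_algebra_carrier_iff monoid_algebra_one fsupp_def)
  show "monoid ?R"
  proof (rule monoidI)
    fix f g h :: "'a \<Rightarrow> 'k"
    assume "f \<in> carrier ?R" "g \<in> carrier ?R" "h \<in> carrier ?R"
    then show "f \<otimes>\<^bsub>?R\<^esub> g \<otimes>\<^bsub>?R\<^esub> h = f \<otimes>\<^bsub>?R\<^esub> (g \<otimes>\<^bsub>?R\<^esub> h)"
      by (intro ext) (simp add: monoid_algebra_carrier_iff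
          monoid_algebra_mult3[of "fsupp f" f "fsupp g" g "fsupp h" h])
  next
    fix f :: "'a \<Rightarrow> 'k" assume f: "f \<in> carrier ?R"
    then have cl: "\<And>c. f c \<noteq> 0 \<Longrightarrow> c \<in> carrier G" "finite (fsupp f)" "fsupp f \<subseteq> carrier G"
      by (auto simp: monoid_algebra_carrier_iff fsupp_def)
    show "\<one>\<^bsub>?R\<^esub> \<otimes>\<^bsub>?R\<^esub> f = f"
    proof
      fix c
      have "(\<one>\<^bsub>?R\<^esub> \<otimes>\<^bsub>?R\<^esub> f) c = (\<Sum>b\<in>fsupp f. if \<one> \<otimes> b = c then f b else 0)"
        using one cl by (subst monoid_algebra_mult[of "{\<one>}" _ "fsupp f"])
          (auto simp: monoid_algebra_one intro!: sum.cong)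
      also have "\<dots> = (\<Sum>b\<in>fsupp f. if b = c then f b else 0)"
        using cl by (intro sum.cong) auto
      also have "\<dots> = f c" using cl by (simp add: fsupp_def)
      finally show "(\<one>\<^bsub>?R\<^esub> \<otimes>\<^bsub>?R\<^esub> f) c = f c" .
    qed
    show "f \<otimes>\<^bsub>?R\<^esub> \<one>\<^bsub>?R\<^esub> = f"
    proof
      fix c
      have "(f \<otimes>\<^bsub>?R\<^esub> \<one>\<^bsub>?R\<^esub>) c = (\<Sum>b\<in>fsupp f. if b \<otimes> \<one> = c then f b else 0)"
        using one cl by (subst monoid_algebra_mult[of "fsupp f" _ "{\<one>}"])
          (auto simp: monoid_algebra_one intro!: sum.cong)
      also have "\<dots> = (\<Sum>b\<in>fsupp f. if b = c then f b else 0)"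
        using cl by (intro sum.cong) auto
      also have "\<dots> = f c" using cl by (simp add: fsupp_def)
      finally show "(f \<otimes>\<^bsub>?R\<^esub> \<one>\<^bsub>?R\<^esub>) c = f c" .
    qed
  qed (use one monoid_algebra_mult_closed in auto)
next
  fix f g h :: "'a \<Rightarrow> 'k"
  assume "f \<in> carrier ?R" "g \<in> carrier ?R" "h \<in> carrier ?R"
  then have fin: "finite (fsupp h)" "finite (fsupp f \<union> fsupp g)"
    by (auto simp: monoid_algebra_carrier_iff)
  have sub: "fsupp (\<lambda>c. f c + g c) \<subseteq> fsupp f \<union> fsupp g" by (auto simp: fsupp_def)
  show "(f \<oplus>\<^bsub>?R\<^esub> g) \<otimes>\<^bsub>?R\<^esub> h = f \<otimes>\<^bsub>?R\<^esub> h \<oplus>\<^bsub>?R\<^esub> g \<otimes>\<^bsub>?R\<^esub> h"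
    using fin sub
    by (intro ext) (auto simp: monoid_algebra_add sum.distrib[symmetric] algebra_simps
        monoid_algebra_mult[of "fsupp f \<union> fsupp g" _ "fsupp h"] intro!: sum.cong)
  show "h \<otimes>\<^bsub>?R\<^esub> (f \<oplus>\<^bsub>?R\<^esub> g) = h \<otimes>\<^bsub>?R\<^esub> f \<oplus>\<^bsub>?R\<^esub> h \<otimes>\<^bsub>?R\<^esub> g"
    using fin sub
    by (intro ext) (auto simp: monoid_algebra_add sum.distrib[symmetric] algebra_simps
        monoid_algebra_mult[of "fsupp h" _ "fsupp f \<union> fsupp g"] intro!: sum.cong)
qed

lemma monoid_algebra_minus:
  fixes f g :: "'a \<Rightarrow> 'k::field"
  assumes "f \<in> carrier (monoid_algebra G)" "g \<in> carrier (monoid_algebra G)"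
  shows "f \<ominus>\<^bsub>monoid_algebra G\<^esub> g = (\<lambda>c. f c - g c)"
proof -
  interpret R: ring "monoid_algebra G :: ('a \<Rightarrow> 'k) ring" by (rule monoid_algebra_ring)
  have "f \<ominus>\<^bsub>monoid_algebra G\<^esub> g \<oplus>\<^bsub>monoid_algebra G\<^esub> g = f"
    using assms by (simp add: R.minus_eq R.a_assoc R.l_neg)
  then show ?thesis
    by (auto simp: monoid_algebra_add fun_eq_iff eq_diff_eq)
qed

text \<open>For a nonzero \<open>f\<close> in the radical, a left inverse \<open>u\<close> of 1 - Qf
  gives u - uQf = 1. With \<open>T\<close> and \<open>F\<close> the top-degree parts of
  \<open>u\<close> and \<open>f\<close>, compare coefficients at the uniquely attained product
  \<open>c\<close>: in uQf it is a product of two nonzero field elements, while \<open>u\<close> and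
  1 vanish at \<open>c\<close>, whose degree exceeds those in \<open>fsupp u\<close> because
  \<open>0 < d\<close>.\<close>

theorem jacobson_radical_monoid_algebra_eq_zero:
  fixes deg :: "'a \<Rightarrow> nat"
  assumes deg: "\<And>a b. a \<in> carrier G \<Longrightarrow> b \<in> carrier G \<Longrightarrow> deg (a \<otimes> b) = deg a + deg b"
    and Q: "finite Q" "Q \<subseteq> carrier G" "\<And>q. q \<in> Q \<Longrightarrow> deg q = d" "0 < d"
    and unique_product: "\<And>T F i j. \<lbrakk>finite T; T \<noteq> {}; T \<subseteq> carrier G; deg ` T \<subseteq> {i};
        finite F; F \<noteq> {}; F \<subseteq> carrier G; deg ` F \<subseteq> {j}\<rbrakk> \<Longrightarrow>
      \<exists>t\<in>T. \<exists>q\<in>Q. \<exists>f\<in>F. \<forall>t'\<in>T. \<forall>q'\<in>Q. \<forall>f'\<in>F.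
        t \<otimes> (q \<otimes> f) = t' \<otimes> (q' \<otimes> f') \<longrightarrow> t' = t \<and> q' = q \<and> f' = f"
  shows "jacobson_radical (monoid_algebra G :: ('a \<Rightarrow> 'k::field) ring)
    = {\<zero>\<^bsub>monoid_algebra G :: ('a \<Rightarrow> 'k) ring\<^esub>}" (is "jacobson_radical ?R = _")
proof -
  interpret R: ring ?R by (rule monoid_algebra_ring)
  have "f = \<zero>\<^bsub>?R\<^esub>" if fJ: "f \<in> jacobson_radical ?R" for f
  proof (rule ccontr)
    assume nz: "f \<noteq> \<zero>\<^bsub>?R\<^esub>"
    have f: "finite (fsupp f)" "fsupp f \<subseteq> carrier G" "f \<in> carrier ?R"
      using fJ by (auto simp: jacobson_radical_def monoid_algebra_carrier_iff)
    have f_ne: "fsupp f \<noteq> {}"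
      using nz by (auto simp: fsupp_def monoid_algebra_zero fun_eq_iff)
    define \<chi> :: "'a \<Rightarrow> 'k" where "\<chi> = (\<lambda>c. if c \<in> Q then 1 else 0)"
    have \<chi>: "fsupp \<chi> \<subseteq> Q" "\<chi> \<in> carrier ?R"
      using Q(1,2) by (auto simp: fsupp_def \<chi>_def monoid_algebra_carrier_iff split: if_splits)
    define g where "g = \<chi> \<otimes>\<^bsub>?R\<^esub> f"
    have g: "g \<in> jacobson_radical ?R" "g \<in> carrier ?R"
      using R.jacobson_radical_left_mult[OF fJ \<chi>(2)]
      by (auto simp: g_def jacobson_radical_def)
    obtain u where u: "u \<in> carrier ?R" "u \<otimes>\<^bsub>?R\<^esub> (\<one>\<^bsub>?R\<^esub> \<ominus>\<^bsub>?R\<^esub> g) = \<one>\<^bsub>?R\<^esub>"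
      using R.jacobson_radical_left_inverse[OF g(1)] by blast
    have u': "finite (fsupp u)" "fsupp u \<subseteq> carrier G"
      using u(1) by (auto simp: monoid_algebra_carrier_iff)
    have "u \<noteq> \<zero>\<^bsub>?R\<^esub>"
    proof
      assume "u = \<zero>\<^bsub>?R\<^esub>"
      then have "\<one>\<^bsub>?R\<^esub> = \<zero>\<^bsub>?R\<^esub>" using u g by simp
      then show False by (auto simp: monoid_algebra_one monoid_algebra_zero fun_eq_iff split: if_splits)
    qed
    then have u_ne: "fsupp u \<noteq> {}"
      by (auto simp: fsupp_def monoid_algebra_zero fun_eq_iff)
    define i where "i = Max (deg ` fsupp u)"
    define j where "j = Max (deg ` fsupp f)"
    have le_i: "deg a \<le> i" if "a \<in> fsupp u" for a using that u' by (simp add: i_def)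
    have le_j: "deg a \<le> j" if "a \<in> fsupp f" for a using that f by (simp add: j_def)
    define T where "T = {a \<in> fsupp u. deg a = i}"
    define F where "F = {a \<in> fsupp f. deg a = j}"
    have "i \<in> deg ` fsupp u" "j \<in> deg ` fsupp f"
      unfolding i_def j_def using u' u_ne f f_ne by (auto intro!: Max_in)
    then have "T \<noteq> {}" "F \<noteq> {}" by (auto simp: T_def F_def)
    moreover have "finite T" "T \<subseteq> carrier G" "deg ` T \<subseteq> {i}"
      "finite F" "F \<subseteq> carrier G" "deg ` F \<subseteq> {j}"
      using u' f by (auto simp: T_def F_def)
    ultimately have "\<exists>t\<in>T. \<exists>q\<in>Q. \<exists>b\<in>F. \<forall>t'\<in>T. \<forall>q'\<in>Q. \<forall>b'\<in>F.
        t \<otimes> (q \<otimes> b) = t' \<otimes> (q' \<otimes> b') \<longrightarrow> t' = t \<and> q' = q \<and> b' = b"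
      by (intro unique_product)
    then obtain t q b where tqb: "t \<in> T" "q \<in> Q" "b \<in> F"
      and uniq: "\<forall>t'\<in>T. \<forall>q'\<in>Q. \<forall>b'\<in>F.
        t \<otimes> (q \<otimes> b) = t' \<otimes> (q' \<otimes> b') \<longrightarrow> t' = t \<and> q' = q \<and> b' = b"
      by (elim bexE)
    define c where "c = t \<otimes> (q \<otimes> b)"
    have cl: "t \<in> carrier G" "q \<in> carrier G" "b \<in> carrier G"
      using tqb Q u' f by (auto simp: T_def F_def)
    have deg_c: "deg c = i + (d + j)"
      using tqb cl Q by (simp add: c_def deg T_def F_def)
    \<comment> \<open>A competing triple need not lie in \<open>T\<close> and \<open>F\<close>; but
      its degrees add up to the maximal total, so both outer factors have top degree and uniqueness
      applies.\<close>
    have only: "t' = t \<and> q' = q \<and> b' = b"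
      if "t' \<in> fsupp u" "q' \<in> Q" "b' \<in> fsupp f" "t' \<otimes> (q' \<otimes> b') = c" for t' q' b'
    proof -
      have "t' \<in> carrier G" "q' \<in> carrier G" "b' \<in> carrier G"
        using that Q u' f by auto
      then have "deg t' + (d + deg b') = i + (d + j)"
        using that(2,4) deg_c Q(3) by (auto simp: deg)
      then have "deg t' = i" "deg b' = j" using le_i[OF that(1)] le_j[OF that(3)] by linarith+
      then show ?thesis
        using uniq that by (auto simp: T_def F_def c_def)
    qed
    have "(u \<otimes>\<^bsub>?R\<^esub> g) c = (\<Sum>t'\<in>fsupp u. \<Sum>q'\<in>Q. \<Sum>b'\<in>fsupp f.
        if t' \<otimes> (q' \<otimes> b') = c then u t' * (\<chi> q' * f b') else 0)"
      unfolding g_def using u' f Q \<chi> by (subst monoid_algebra_mult3(1)) auto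
    also have "\<dots> = (\<Sum>t'\<in>fsupp u. \<Sum>q'\<in>Q. \<Sum>b'\<in>fsupp f.
        if t' = t then if q' = q then if b' = b then u t * f b else 0 else 0 else 0)"
      using only by (intro sum.cong HOL.refl) (auto simp: c_def \<chi>_def tqb)
    also have "\<dots> = (\<Sum>t'\<in>fsupp u. if t' = t then u t * f b else 0)"
    proof (rule sum.cong[OF HOL.refl])
      fix t'
      have "(\<Sum>b'\<in>fsupp f. if t' = t then if q' = q then if b' = b then u t * f b else 0 else 0 else 0)
          = (if t' = t then if q' = q then u t * f b else 0 else 0)" for q'
        using f tqb by (cases "t' = t"; cases "q' = q") (auto simp: F_def)
      then show "(\<Sum>q'\<in>Q. \<Sum>b'\<in>fsupp f.
          if t' = t then if q' = q then if b' = b then u t * f b else 0 else 0 else 0)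
          = (if t' = t then u t * f b else 0)"
        using Q tqb by (cases "t' = t") auto
    qed
    also have "\<dots> = u t * f b"
      using u' tqb by (auto simp: T_def)
    finally have "(u \<otimes>\<^bsub>?R\<^esub> g) c \<noteq> 0"
      using tqb by (auto simp: T_def F_def fsupp_def)
    moreover have "u c = 0"
      using le_i[of c] deg_c Q(4) by (auto simp: fsupp_def)
    moreover have "(\<one>\<^bsub>?R\<^esub> :: 'a \<Rightarrow> 'k) c = 0"
    proof -
      have "deg \<one> = 0" using deg[of \<one> \<one>] by simp
      then have "c \<noteq> \<one>" using deg_c Q(4) by auto
      then show ?thesis by (simp add: monoid_algebra_one)
    qed
    moreover have "u \<otimes>\<^bsub>?R\<^esub> (\<one>\<^bsub>?R\<^esub> \<ominus>\<^bsub>?R\<^esub> g) = u \<ominus>\<^bsub>?R\<^esub> (u \<otimes>\<^bsub>?R\<^esub> g)"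
      using u g by (simp add: R.minus_eq R.r_distr R.r_minus)
    then have "(\<lambda>c. u c - (u \<otimes>\<^bsub>?R\<^esub> g) c) = \<one>\<^bsub>?R\<^esub>"
      using u g by (simp add: monoid_algebra_minus)
    then have "u c - (u \<otimes>\<^bsub>?R\<^esub> g) c = (\<one>\<^bsub>?R\<^esub> :: 'a \<Rightarrow> 'k) c"
      by (rule fun_cong)
    ultimately show False by simp
  qed
  then show ?thesis using R.zero_in_jacobson_radical by blast
qed

end

section \<open>The monoid defined by permutation relations\<close>

lemma sn_eq_length: "sn_eq n H u v \<Longrightarrow> length u = length v"
  by (induction rule: sn_eq.induct) auto

lemma sn_eq_append_context: "sn_eq n H u v \<Longrightarrow> sn_eq n H (a @ u @ b) (a @ v @ b)"
proof (induction rule: sn_eq.induct)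
  case (rel s u v)
  then show ?case using sn_eq.rel[of s H n "a @ u" "v @ b"] by simp
qed (auto intro: sn_eq.intros)

lemma sn_eq_append:
  assumes "sn_eq n H u u'" "sn_eq n H v v'"
  shows "sn_eq n H (u @ v) (u' @ v')"
  using sn_eq_append_context[OF assms(1), of "[]" v] sn_eq_append_context[OF assms(2), of u' "[]"]
  by (auto intro: sn_eq.trans)

lemma sn_class_eq_iff: "sn_class n H u = sn_class n H v \<longleftrightarrow> sn_eq n H u v"
  unfolding sn_class_def by (blast intro: sn_eq.intros)

lemma sn_mult_class: "sn_mult n H (sn_class n H u) (sn_class n H v) = sn_class n H (u @ v)"
  unfolding sn_mult_def sn_class_def
  by (blast intro: sn_eq.refl sn_eq.trans sn_eq_append)

definition sn_struct :: "nat \<Rightarrow> (nat \<Rightarrow> nat) set \<Rightarrow> nat list set monoid" where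
  "sn_struct n H = \<lparr>carrier = sn_monoid n H, mult = sn_mult n H, one = sn_class n H []\<rparr>"

lemma sn_algebra_eq_monoid_algebra: "sn_algebra n H = monoid_algebra (sn_struct n H)"
  by (simp add: sn_algebra_def monoid_algebra_def sn_struct_def)

lemma monoid_sn_struct: "monoid (sn_struct n H)"
  by (rule monoidI) (auto simp: sn_struct_def sn_monoid_def sn_mult_class)

text \<open>Transfer to words: the degree is the length of a chosen representative, and congruent
  words have equal length. Uniqueness is then needed only up to congruence in the outer
  factors.\<close>

theorem jacobson_radical_sn_algebra_eq_zero:
  assumes Q: "finite Q" "\<And>q. q \<in> Q \<Longrightarrow> set q \<subseteq> {1..n} \<and> length q = d" "0 < d"
    and unique_product: "\<And>T F i j. \<lbrakk>finite T; T \<noteq> {}; \<forall>t\<in>T. set t \<subseteq> {1..n} \<and> length t = i;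
        finite F; F \<noteq> {}; \<forall>f\<in>F. set f \<subseteq> {1..n} \<and> length f = j\<rbrakk> \<Longrightarrow>
      \<exists>t\<in>T. \<exists>q\<in>Q. \<exists>f\<in>F. \<forall>t'\<in>T. \<forall>q'\<in>Q. \<forall>f'\<in>F.
        sn_eq n H (t @ q @ f) (t' @ q' @ f') \<longrightarrow> sn_eq n H t' t \<and> q' = q \<and> sn_eq n H f' f"
  shows "jacobson_radical (sn_algebra n H :: (nat list set \<Rightarrow> 'k::field) ring)
    = {\<zero>\<^bsub>sn_algebra n H :: (nat list set \<Rightarrow> 'k) ring\<^esub>}"
proof -
  let ?S = "sn_struct n H" and ?c = "sn_class n H"
  define rep where "rep c = (SOME w. set w \<subseteq> {1..n} \<and> ?c w = c)" for c
  have rep: "set (rep c) \<subseteq> {1..n}" "?c (rep c) = c" if "c \<in> carrier ?S" for c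
    using that someI_ex[of "\<lambda>w. set w \<subseteq> {1..n} \<and> ?c w = c"]
    unfolding rep_def sn_struct_def sn_monoid_def by auto
  have cl: "?c w \<in> carrier ?S" if "set w \<subseteq> {1..n}" for w
    using that by (auto simp: sn_struct_def sn_monoid_def)
  have mult: "?c u \<otimes>\<^bsub>?S\<^esub> ?c v = ?c (u @ v)" for u v
    by (simp add: sn_struct_def sn_mult_class)
  have len_rep: "length (rep (?c w)) = length w" if "set w \<subseteq> {1..n}" for w
    using rep(2)[OF cl[OF that]] sn_class_eq_iff sn_eq_length by metis
  show ?thesis
    unfolding sn_algebra_eq_monoid_algebra
  proof (rule monoid.jacobson_radical_monoid_algebra_eq_zero[OF monoid_sn_struct,
        of n H "\<lambda>c. length (rep c)" "?c ` Q" d])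
    fix a b assume ab: "a \<in> carrier ?S" "b \<in> carrier ?S"
    have "a \<otimes>\<^bsub>?S\<^esub> b = ?c (rep a @ rep b)"
      using rep(2)[OF ab(1)] rep(2)[OF ab(2)] mult by metis
    then show "length (rep (a \<otimes>\<^bsub>?S\<^esub> b)) = length (rep a) + length (rep b)"
      using len_rep[of "rep a @ rep b"] rep(1)[OF ab(1)] rep(1)[OF ab(2)] by simp
  next
    fix T F :: "nat list set set" and i j
    assume T: "finite T" "T \<noteq> {}" "T \<subseteq> carrier ?S" "(\<lambda>c. length (rep c)) ` T \<subseteq> {i}"
      and F: "finite F" "F \<noteq> {}" "F \<subseteq> carrier ?S" "(\<lambda>c. length (rep c)) ` F \<subseteq> {j}"
    have "\<exists>t\<in>rep ` T. \<exists>q\<in>Q. \<exists>f\<in>rep ` F. \<forall>t'\<in>rep ` T. \<forall>q'\<in>Q. \<forall>f'\<in>rep ` F.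
        sn_eq n H (t @ q @ f) (t' @ q' @ f') \<longrightarrow> sn_eq n H t' t \<and> q' = q \<and> sn_eq n H f' f"
      using T F rep(1) by (intro unique_product[of _ i _ j]) blast+
    then have "\<exists>t\<in>T. \<exists>q\<in>Q. \<exists>f\<in>F. \<forall>t'\<in>T. \<forall>q'\<in>Q. \<forall>f'\<in>F.
        sn_eq n H (rep t @ q @ rep f) (rep t' @ q' @ rep f') \<longrightarrow>
        sn_eq n H (rep t') (rep t) \<and> q' = q \<and> sn_eq n H (rep f') (rep f)"
      by simp
    then obtain t q f where tqf: "t \<in> T" "q \<in> Q" "f \<in> F"
      and uniq: "\<forall>t'\<in>T. \<forall>q'\<in>Q. \<forall>f'\<in>F.
        sn_eq n H (rep t @ q @ rep f) (rep t' @ q' @ rep f') \<longrightarrow>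
        sn_eq n H (rep t') (rep t) \<and> q' = q \<and> sn_eq n H (rep f') (rep f)"
      by (elim bexE)
    have "t' = t \<and> ?c q' = ?c q \<and> f' = f"
      if A: "t' \<in> T" "q' \<in> Q" "f' \<in> F"
        and eq: "t \<otimes>\<^bsub>?S\<^esub> (?c q \<otimes>\<^bsub>?S\<^esub> f) = t' \<otimes>\<^bsub>?S\<^esub> (?c q' \<otimes>\<^bsub>?S\<^esub> f')" for t' q' f'
    proof -
      have r: "?c (rep t) = t" "?c (rep f) = f" "?c (rep t') = t'" "?c (rep f') = f'"
        using rep(2) tqf A T(3) F(3) by auto
      have "?c (rep t @ q @ rep f) = ?c (rep t' @ q' @ rep f')"
        using eq r mult by metis
      then show ?thesis
        using uniq A r sn_class_eq_iff by metis
    qed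
    then show "\<exists>t\<in>T. \<exists>q\<in>?c ` Q. \<exists>f\<in>F. \<forall>t'\<in>T. \<forall>q'\<in>?c ` Q. \<forall>f'\<in>F.
        t \<otimes>\<^bsub>?S\<^esub> (q \<otimes>\<^bsub>?S\<^esub> f) = t' \<otimes>\<^bsub>?S\<^esub> (q' \<otimes>\<^bsub>?S\<^esub> f') \<longrightarrow> t' = t \<and> q' = q \<and> f' = f"
      using tqf by (intro bexI[of _ t] bexI[of _ "?c q"] bexI[of _ f]) auto
  qed (use Q cl len_rep in auto)
qed

lemma set_base_word: "set (base_word n) = {1..n}"
  and length_base_word: "length (base_word n) = n"
  and distinct_base_word: "distinct (base_word n)"
  by (auto simp: base_word_def)

lemma nth_base_word: "i < n \<Longrightarrow> base_word n ! i = Suc i"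
  by (simp add: base_word_def del: upt_Suc)

section \<open>Non-transitive permutation groups and small degrees\<close>

text \<open>A factor reaching across the two adjacent copies of \<open>a\<close> would contain both,
  contrary to distinctness. Applied to relators and, later, to left sides of rules.\<close>

lemma distinct_factor_cases:
  assumes eq: "u @ w @ v = p @ [a, a] @ s" and "distinct w"
  obtains (left) r where "p @ [a] = u @ w @ r" "v = r @ [a] @ s"
    | (right) r where "[a] @ s = r @ w @ v" "u = p @ [a] @ r"
proof -
  have "(u @ w) @ v = (p @ [a]) @ ([a] @ s)" using eq by simp
  then consider r where "u @ w = (p @ [a]) @ r" "r @ v = [a] @ s"
    | r where "(u @ w) @ r = p @ [a]" "v = r @ [a] @ s"
    unfolding append_eq_append_conv2[of "u @ w"] by blast
  then show thesis
  proof cases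
    case (1 r)
    from 1(1) consider m where "u = (p @ [a]) @ m" "m @ w = r"
      | m where "u @ m = p @ [a]" "w = m @ r"
      unfolding append_eq_append_conv2[of u] by blast
    then show thesis
    proof cases
      case (1 m)
      then have "[a] @ s = m @ w @ v" using \<open>r @ v = [a] @ s\<close> by auto
      then show thesis using right[of m] 1(1) by simp
    next
      case (2 m)
      show thesis
      proof (cases "m = [] \<or> r = []")
        case True
        then show thesis using left[of "[]"] right[of "[]"] 2 \<open>r @ v = [a] @ s\<close> by auto
      next
        case False
        have "a \<in> set m" using False 2(1) by (metis last_appendR last_in_set last_snoc)
        moreover have "a \<in> set r" using False \<open>r @ v = [a] @ s\<close> by (cases r) auto
        ultimately show thesis using \<open>distinct w\<close> 2(2) by auto
      qed
    qed
  next
    case (2 r)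
    then show thesis using left[of r] by simp
  qed
qed

text \<open>If no relator starts with x or ends with y, no relator overlaps the separator yyxx.\<close>

lemma factor_within_separated:
  assumes eq: "u @ w @ v = t @ [y, y, x, x] @ f"
    and w: "distinct w" "length w \<ge> 3" "hd w \<noteq> x" "last w \<noteq> y"
  obtains (left) r where "t = u @ w @ r" "v = r @ [y, y, x, x] @ f"
    | (right) r where "f = r @ w @ v" "u = t @ [y, y, x, x] @ r"
proof -
  have "w \<noteq> []" using w(2) by auto
  have "u @ w @ v = t @ [y, y] @ (x # x # f)" using eq by simp
  then show thesis using w(1)
  proof (cases rule: distinct_factor_cases)
    case (left r)
    \<comment> \<open>If \<open>w\<close> ended at the first \<open>y\<close> itself, its last
      letter would be \<open>y\<close>; so that \<open>y\<close> belongs to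
      \<open>r\<close>.\<close>
    then have "r \<noteq> []" using w(4) \<open>w \<noteq> []\<close> by (metis append_Nil2 last_appendR last_snoc)
    then obtain r' where "r = r' @ [y]" using left(1) by (cases r rule: rev_cases) auto
    then show thesis using left that(1)[of r'] by simp
  next
    case (right r)
    note outer = right
    then have "r @ w @ v = [y] @ [x, x] @ f" by simp
    then show thesis using w(1)
    proof (cases rule: distinct_factor_cases)
      \<comment> \<open>Here \<open>w\<close> would have to fit between the two cuts, inside the two
        letters \<open>y\<close>, \<open>x\<close>.\<close>
      case (left r')
      have "length w \<le> length (r @ w @ r')" by simp
      also have "\<dots> = length ([y] @ [x])" unfolding left(1) ..
      finally have "length w \<le> 2" by simp
      then show thesis using w(2) by simp
    next
      case (right r')
      then obtain r'' where "r' = x # r''"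
        using w(3) \<open>w \<noteq> []\<close> by (cases r') (auto simp: neq_Nil_conv)
      then show thesis using right outer that(2)[of r''] by simp
    qed
  qed
qed

text \<open>Every relator lies on one side of the separator. Both directions are carried along to
  make the symmetric case of the induction trivial; since \<open>id \<in> H\<close>, the base word
  is itself of the form \<open>map s (base_word n)\<close>, so one argument serves both sides of a
  relation.\<close>

lemma sn_eq_separated:
  assumes W: "\<And>s. s \<in> H \<Longrightarrow> s permutes {1..n} \<and> s 1 \<noteq> x \<and> s n \<noteq> y"
    and "id \<in> H" "n \<ge> 3"
    and "sn_eq n H U V"
  shows "(\<forall>t f. U = t @ [y, y, x, x] @ f \<longrightarrow>
      (\<exists>t' f'. V = t' @ [y, y, x, x] @ f' \<and> sn_eq n H t t' \<and> sn_eq n H f f')) \<and>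
    (\<forall>t f. V = t @ [y, y, x, x] @ f \<longrightarrow>
      (\<exists>t' f'. U = t' @ [y, y, x, x] @ f' \<and> sn_eq n H t t' \<and> sn_eq n H f f'))"
  using assms(4)
proof (induction rule: sn_eq.induct)
  case (rel s u v)
  have hl: "distinct (map s (base_word n))" "length (map s (base_word n)) \<ge> 3"
    "hd (map s (base_word n)) \<noteq> x" "last (map s (base_word n)) \<noteq> y" if "s \<in> H" for s
    using W[OF that] \<open>n \<ge> 3\<close> permutes_inj_on[of s "{1..n}"]
    by (auto simp: base_word_def distinct_map hd_map last_map simp del: upt_Suc intro: inj_on_subset)
  have step: "\<exists>t' f'. u @ w' @ v = t' @ [y, y, x, x] @ f' \<and> sn_eq n H t t' \<and> sn_eq n H f f'"
    if eq: "u @ w @ v = t @ [y, y, x, x] @ f" and w: "w = map s (base_word n)" "s \<in> H"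
      and ww': "sn_eq n H w w'" for t f w w' s
  proof -
    have "distinct w" "length w \<ge> 3" "hd w \<noteq> x" "last w \<noteq> y" using hl w by auto
    with eq show ?thesis
    proof (cases rule: factor_within_separated)
      case (left r)
      then have "u @ w' @ v = (u @ w' @ r) @ [y, y, x, x] @ f" by simp
      moreover have "sn_eq n H t (u @ w' @ r)"
        using left(1) sn_eq_append_context[OF ww'] by simp
      ultimately show ?thesis using sn_eq.refl by blast
    next
      case (right r)
      then have "u @ w' @ v = t @ [y, y, x, x] @ (r @ w' @ v)" by simp
      moreover have "sn_eq n H f (r @ w' @ v)"
        using right(1) sn_eq_append_context[OF ww'] by simp
      ultimately show ?thesis using sn_eq.refl by blast
    qed
  qed
  have b: "sn_eq n H (base_word n) (map s (base_word n))"
    using sn_eq.rel[OF rel, of n "[]" "[]"] by simp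
  show ?case
    using step[OF _ _ \<open>id \<in> H\<close> b] step[OF _ HOL.refl rel sn_eq.sym[OF b]] by simp
next
  case (trans u v w)
  note IH = trans.IH
  show ?case
  proof (intro conjI allI impI)
    fix t f assume "u = t @ [y, y, x, x] @ f"
    then obtain t1 f1 where 1: "v = t1 @ [y, y, x, x] @ f1" "sn_eq n H t t1" "sn_eq n H f f1"
      using IH(1) by blast
    then obtain t2 f2 where 2: "w = t2 @ [y, y, x, x] @ f2" "sn_eq n H t1 t2" "sn_eq n H f1 f2"
      using IH(2) by blast
    show "\<exists>t' f'. w = t' @ [y, y, x, x] @ f' \<and> sn_eq n H t t' \<and> sn_eq n H f f'"
      by (intro exI conjI, rule 2(1)) (rule sn_eq.trans[OF 1(2) 2(2)] sn_eq.trans[OF 1(3) 2(3)])+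
  next
    fix t f assume "w = t @ [y, y, x, x] @ f"
    then obtain t1 f1 where 1: "v = t1 @ [y, y, x, x] @ f1" "sn_eq n H t t1" "sn_eq n H f f1"
      using IH(2) by blast
    then obtain t2 f2 where 2: "u = t2 @ [y, y, x, x] @ f2" "sn_eq n H t1 t2" "sn_eq n H f1 f2"
      using IH(1) by blast
    show "\<exists>t' f'. u = t' @ [y, y, x, x] @ f' \<and> sn_eq n H t t' \<and> sn_eq n H f f'"
      by (intro exI conjI, rule 2(1)) (rule sn_eq.trans[OF 1(2) 2(2)] sn_eq.trans[OF 1(3) 2(3)])+
  qed
next
  case (refl w)
  then show ?case using sn_eq.refl by blast
next
  case (sym u v)
  then show ?case by blast
qed

lemma jacobson_radical_sn_algebra_non_transitive:
  assumes W: "\<And>s. s \<in> H \<Longrightarrow> s permutes {1..n} \<and> s 1 \<noteq> x \<and> s n \<noteq> y"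
    and "id \<in> H" "n \<ge> 3" "x \<in> {1..n}" "y \<in> {1..n}"
  shows "jacobson_radical (sn_algebra n H :: (nat list set \<Rightarrow> 'k::field) ring)
    = {\<zero>\<^bsub>sn_algebra n H :: (nat list set \<Rightarrow> 'k) ring\<^esub>}"
proof (rule jacobson_radical_sn_algebra_eq_zero[of "{[y, y, x, x]}" n 4])
  fix T F :: "nat list set" and i j
  assume T: "T \<noteq> {}" "\<forall>t\<in>T. set t \<subseteq> {1..n} \<and> length t = i"
    and F: "F \<noteq> {}" "\<forall>f\<in>F. set f \<subseteq> {1..n} \<and> length f = j"
  from T(1) F(1) obtain t f where tf: "t \<in> T" "f \<in> F" by blast
  have "sn_eq n H t' t \<and> sn_eq n H f' f"
    if t'f': "t' \<in> T" "f' \<in> F" and U: "sn_eq n H (t @ [y, y, x, x] @ f) (t' @ [y, y, x, x] @ f')" for t' f'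
  proof -
    obtain t'' f'' where
      eq: "t @ [y, y, x, x] @ f = t'' @ [y, y, x, x] @ f''" "sn_eq n H t' t''" "sn_eq n H f' f''"
      using sn_eq_separated[OF W assms(2,3) U] by blast
    \<comment> \<open>The separator might occur elsewhere in the word too; equal lengths show that
      it is the same occurrence.\<close>
    have "length t = length t''"
      using T(2) tf t'f' sn_eq_length[OF eq(2)] by simp
    then show ?thesis using eq by simp
  qed
  then show "\<exists>t\<in>T. \<exists>q\<in>{[y, y, x, x]}. \<exists>f\<in>F. \<forall>t'\<in>T. \<forall>q'\<in>{[y, y, x, x]}. \<forall>f'\<in>F.
      sn_eq n H (t @ q @ f) (t' @ q' @ f') \<longrightarrow> sn_eq n H t' t \<and> q' = q \<and> sn_eq n H f' f"
    using tf by blast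
qed (use assms in auto)

text \<open>With trivial relations the monoid is free, and fixed lengths determine the factors;
  \<open>[1]\<close> only provides positive degree.\<close>

lemma jacobson_radical_sn_algebra_trivial:
  assumes "\<And>s. s \<in> H \<Longrightarrow> map s (base_word n) = base_word n" "n \<ge> 1"
  shows "jacobson_radical (sn_algebra n H :: (nat list set \<Rightarrow> 'k::field) ring)
    = {\<zero>\<^bsub>sn_algebra n H :: (nat list set \<Rightarrow> 'k) ring\<^esub>}"
proof (rule jacobson_radical_sn_algebra_eq_zero[of "{[1]}" n 1])
  fix T F :: "nat list set" and i j
  assume T: "T \<noteq> {}" "\<forall>t\<in>T. set t \<subseteq> {1..n} \<and> length t = i"
    and F: "F \<noteq> {}" "\<forall>f\<in>F. set f \<subseteq> {1..n} \<and> length f = j"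
  have eq: "sn_eq n H u v \<longleftrightarrow> u = v" for u v
  proof
    show "u = v" if "sn_eq n H u v"
      using that by (induction rule: sn_eq.induct) (use assms in auto)
  qed (auto intro: sn_eq.refl)
  from T(1) F(1) obtain t f where "t \<in> T" "f \<in> F" by blast
  then show "\<exists>t\<in>T. \<exists>q\<in>{[1]}. \<exists>f\<in>F. \<forall>t'\<in>T. \<forall>q'\<in>{[1]}. \<forall>f'\<in>F.
      sn_eq n H (t @ q @ f) (t' @ q' @ f') \<longrightarrow> sn_eq n H t' t \<and> q' = q \<and> sn_eq n H f' f"
    using T F by (intro bexI[of _ t] bexI[of _ "[1]"] bexI[of _ f]) (auto simp: eq)
qed (use assms in auto)

text \<open>The two letters commute, so the class of a word is determined by its length and its
  number of 1s. Taking this number maximal in \<open>T\<close> and in \<open>F\<close> makes the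
  product unique.\<close>

lemma jacobson_radical_sn_algebra_swap:
  assumes H: "s \<in> H" "s 1 = 2" "s 2 = 1" "\<And>s. s \<in> H \<Longrightarrow> s permutes {1..2}"
  shows "jacobson_radical (sn_algebra 2 H :: (nat list set \<Rightarrow> 'k::field) ring)
    = {\<zero>\<^bsub>sn_algebra 2 H :: (nat list set \<Rightarrow> 'k) ring\<^esub>}"
proof (rule jacobson_radical_sn_algebra_eq_zero[of "{[1]}" 2 1])
  have b: "base_word 2 = [1, 2]" by (simp add: base_word_def upt_rec)
  have swap: "sn_eq 2 H [1, 2] [2, 1]"
    using sn_eq.rel[OF H(1), of 2 "[]" "[]"] H(2,3) by (simp add: b)
  have two: "sn_eq 2 H (2 # replicate a 1 @ r) (replicate a 1 @ 2 # r)" for a r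
  proof (induction a)
    case (Suc a)
    have "sn_eq 2 H (2 # 1 # replicate a 1 @ r) (1 # 2 # replicate a 1 @ r)"
      using sn_eq_append_context[OF sn_eq.sym[OF swap], of "[]"] by simp
    moreover have "sn_eq 2 H (1 # 2 # replicate a 1 @ r) (1 # replicate a 1 @ 2 # r)"
      using sn_eq_append_context[OF Suc, of "[1]" "[]"] by simp
    ultimately show ?case by (auto intro: sn_eq.trans)
  qed (auto intro: sn_eq.refl)
  have normal: "sn_eq 2 H w (replicate (count_list w 1) 1 @ replicate (length w - count_list w 1) 2)"
    if "set w \<subseteq> {1..2}" for w
    using that
  proof (induction w)
    case (Cons a w)
    have le: "count_list w 1 \<le> length w" by (rule count_le_length)
    have IH: "sn_eq 2 H (a # w) (a # replicate (count_list w 1) 1 @ replicate (length w - count_list w 1) 2)"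
      using sn_eq_append_context[OF Cons.IH, of "[a]" "[]"] Cons.prems by simp
    have "a = 1 \<or> a = 2" using Cons.prems by auto
    then show ?case
    proof
      assume "a = 1"
      then show ?thesis using IH by simp
    next
      assume a: "a = 2"
      then show ?thesis
        using IH two[of "count_list w 1" "replicate (length w - count_list w 1) 2"] le
        by (auto simp: Suc_diff_le intro: sn_eq.trans)
    qed
  qed (auto intro: sn_eq.refl)
  have "mset u = mset v" if "sn_eq 2 H u v" for u v
    using that
  proof (induction rule: sn_eq.induct)
    case (rel s u v)
    have "inj_on s {1..2}" "s ` {1..2} = {1..2}"
      using H(4)[OF rel] permutes_inj_on permutes_image by blast+
    then have "image_mset s (mset_set {1..2}) = mset_set {1..2}"
      by (simp add: image_mset_mset_set)
    moreover have "mset (base_word 2) = mset_set {1..2}"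
      using mset_set_set[OF distinct_base_word] by (simp add: set_base_word)
    ultimately show ?case by simp
  qed auto
  then have count: "count_list u 1 = count_list v 1" if "sn_eq 2 H u v" for u v
    using that by (metis count_mset)
  fix T F :: "nat list set" and i j
  assume T: "finite T" "T \<noteq> {}" "\<forall>t\<in>T. set t \<subseteq> {1..2} \<and> length t = i"
    and F: "finite F" "F \<noteq> {}" "\<forall>f\<in>F. set f \<subseteq> {1..2} \<and> length f = j"
  obtain t where t: "t \<in> T" "\<And>t'. t' \<in> T \<Longrightarrow> count_list t' 1 \<le> count_list t 1"
    using finite_has_maximal[of "(\<lambda>t. count_list t 1) ` T"] T(1,2)
      Max_in[of "(\<lambda>t. count_list t 1) ` T"] Max_ge[of "(\<lambda>t. count_list t 1) ` T"]
    by (smt (verit) finite_imageI image_iff image_is_empty)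
  obtain f where f: "f \<in> F" "\<And>t'. t' \<in> F \<Longrightarrow> count_list t' 1 \<le> count_list f 1"
    using Max_in[of "(\<lambda>t. count_list t 1) ` F"] Max_ge[of "(\<lambda>t. count_list t 1) ` F"] F(1,2)
    by (smt (verit) finite_imageI image_iff image_is_empty)
  have "sn_eq 2 H t' t \<and> sn_eq 2 H f' f"
    if t'f': "t' \<in> T" "f' \<in> F" and eq: "sn_eq 2 H (t @ [1] @ f) (t' @ [1] @ f')" for t' f'
  proof -
    have "count_list t 1 = count_list t' 1" "count_list f 1 = count_list f' 1"
      using count[OF eq] t(2)[OF t'f'(1)] f(2)[OF t'f'(2)] by auto
    then have "sn_eq 2 H t (replicate (count_list t' 1) 1 @ replicate (length t' - count_list t' 1) 2)"
      "sn_eq 2 H f (replicate (count_list f' 1) 1 @ replicate (length f' - count_list f' 1) 2)"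
      using normal[of t] normal[of f] T(3) F(3) t(1) f(1) t'f' by auto
    moreover have "set t' \<subseteq> {1..2}" "set f' \<subseteq> {1..2}" using T(3) F(3) t'f' by auto
    ultimately show ?thesis
      using normal[of t'] normal[of f'] sn_eq.sym sn_eq.trans by blast
  qed
  then show "\<exists>t\<in>T. \<exists>q\<in>{[1]}. \<exists>f\<in>F. \<forall>t'\<in>T. \<forall>q'\<in>{[1]}. \<forall>f'\<in>F.
      sn_eq 2 H (t @ q @ f) (t' @ q' @ f') \<longrightarrow> sn_eq 2 H t' t \<and> q' = q \<and> sn_eq 2 H f' f"
    using t(1) f(1) by blast
qed auto

section \<open>Rewriting for regular relators\<close>

lemma append_Cons_eq_notin:
  "xs @ x # ys = xs' @ x # ys' \<Longrightarrow> x \<notin> set xs \<Longrightarrow> x \<notin> set xs' \<Longrightarrow> xs = xs' \<and> ys = ys'"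
proof (induction xs arbitrary: xs')
  case Nil
  then show ?case by (cases xs') auto
next
  case (Cons a xs)
  then show ?case by (cases xs') auto
qed

text \<open>Abstracts what rewriting needs from the relators of a regular abelian group.
  \<open>nth_inject\<close> is regularity. \<open>shift_prefix\<close> is where commutativity
  enters: it closes the one critical pair that is not automatic. By \<open>rotate_all\<close>, a
  rotation by one letter that occurs for some letter occurs for all, which makes z central.\<close>

locale relator_words =
  fixes W :: "nat list set" and n :: nat
  assumes three_le: "3 \<le> n"
    and length_W: "w \<in> W \<Longrightarrow> length w = n"
    and distinct_W: "w \<in> W \<Longrightarrow> distinct w"
    and set_W: "w \<in> W \<Longrightarrow> set w = {1..n}"
    and nth_inject: "w \<in> W \<Longrightarrow> w' \<in> W \<Longrightarrow> i < n \<Longrightarrow> w ! i = w' ! i \<Longrightarrow> w = w'"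
    and shift_prefix: "a @ u @ c \<in> W \<Longrightarrow> c @ v \<in> W \<Longrightarrow> u @ c' \<in> W \<Longrightarrow> c' @ v' \<in> W \<Longrightarrow>
      a \<noteq> [] \<Longrightarrow> u \<noteq> [] \<Longrightarrow> c \<noteq> [] \<Longrightarrow> \<exists>m. c' = c @ m"
    and rotate_all: "x # c \<in> W \<Longrightarrow> c @ [x] \<in> W \<Longrightarrow> y \<in> {1..n} \<Longrightarrow> \<exists>d. y # d \<in> W \<and> d @ [y] \<in> W"
begin

text \<open>The letter 0 stands for the common value z of all relators. Overlapping relators uc and cv
  give uz = zv.\<close>

inductive rule :: "nat list \<Rightarrow> nat list \<Rightarrow> bool" where
  contract: "w \<in> W \<Longrightarrow> rule w [0]"
| move: "u @ c \<in> W \<Longrightarrow> c @ v \<in> W \<Longrightarrow> u \<noteq> [] \<Longrightarrow> c \<noteq> [] \<Longrightarrow> rule (u @ [0]) (0 # v)"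

inductive step :: "nat list \<Rightarrow> nat list \<Rightarrow> bool" where
  stepI: "rule l r \<Longrightarrow> step (p @ l @ s) (p @ r @ s)"

abbreviation steps :: "nat list \<Rightarrow> nat list \<Rightarrow> bool" where "steps \<equiv> step\<^sup>*\<^sup>*"

definition irr :: "nat list \<Rightarrow> bool" where "irr w \<longleftrightarrow> (\<forall>v. \<not> step w v)"

lemma zero_notin_W: "w \<in> W \<Longrightarrow> 0 \<notin> set w"
  using set_W by auto

lemma append_W_cancel: "a @ c \<in> W \<Longrightarrow> a @ c' \<in> W \<Longrightarrow> a \<noteq> [] \<Longrightarrow> c = c'"
  using nth_inject[of "a @ c" "a @ c'" 0] three_le by (auto simp: nth_append)

lemma rule_distinct: "rule l r \<Longrightarrow> distinct l"
proof (induction rule: rule.induct)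
  case (move u c v)
  then show ?case using distinct_W[OF move(1)] zero_notin_W[OF move(1)] by simp
qed (rule distinct_W)

text \<open>Consequently a leading 0 is never rewritten, and a reduction at the front of a word puts
  a 0 there.\<close>

lemma rule_hd:
  assumes "rule l r"
  shows "\<exists>a l'. l = a # l' \<and> a \<noteq> 0" "\<exists>r'. r = 0 # r'"
proof -
  show "\<exists>a l'. l = a # l' \<and> a \<noteq> 0" using assms
  proof (cases rule: rule.cases)
    case contract
    show ?thesis
      using length_W[OF contract(2)] zero_notin_W[OF contract(2)] three_le by (cases l) auto
  next
    case (move u c v)
    then show ?thesis using zero_notin_W[OF move(3)] by (cases u) auto
  qed
  show "\<exists>r'. r = 0 # r'" using assms by (cases rule: rule.cases) auto
qed

section \<open>Critical pairs and local confluence\<close>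

lemma step_append: "step u v \<Longrightarrow> step (p @ u @ s) (p @ v @ s)"
proof (induction rule: step.induct)
  case (stepI l r p' s')
  then show ?case using step.stepI[of l r "p @ p'" "s' @ s"] by simp
qed

lemma steps_append: "steps u v \<Longrightarrow> steps (p @ u @ s) (p @ v @ s)"
  by (induction rule: rtranclp_induct) (auto intro: step_append rtranclp.rtrancl_into_rtrancl)

lemma rule_steps: "rule l r \<Longrightarrow> steps (p @ l @ s) (p @ r @ s)"
  by (blast intro: step.stepI)

text \<open>Here \<open>e\<close> is the part of the first left side from the start of the second
  one on. Two relators overlapping in \<open>e\<close> produce an instance of \<open>move\<close>,
  the reason for that rule. A relator starting inside a left side of \<open>move\<close> is too long
  to end before its 0. Only two \<open>move\<close> rules meeting at the same 0 require
  \<open>shift_prefix\<close>.\<close>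

lemma overlap_joinable:
  assumes r1: "rule (d @ e) r1" and r2: "rule l2 r2" and "e \<noteq> []" and eq: "e @ s1 = l2 @ s2"
  shows "\<exists>x. steps (r1 @ s1) x \<and> steps (d @ r2 @ s2) x"
  using r1
proof (cases rule: rule.cases)
  case c1: contract
  show ?thesis using r2
  proof (cases rule: rule.cases)
    case c2: contract
    show ?thesis
    proof (cases "d = []")
      case True
      have "e = l2"
        using eq True c1 c2 length_W by (metis append_Nil append_eq_append_conv)
      then show ?thesis using eq True c1 c2 by auto
    next
      case False
      have "length e \<le> length l2" using c1 c2 length_W[of "d @ e"] length_W[of l2] by auto
      then obtain g where g: "l2 = e @ g" "s1 = g @ s2"
        using eq by (auto simp: append_eq_append_conv2)
      have "rule (d @ [0]) (0 # g)" using move[of d e g] c1 c2 g False \<open>e \<noteq> []\<close> by simp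
      then have "steps ([] @ (d @ [0]) @ s2) ([] @ (0 # g) @ s2)" by (rule rule_steps)
      then show ?thesis using c1 c2 g by auto
    qed
  next
    case m2: (move u c v)
    have "0 \<notin> set e" using zero_notin_W[OF c1(2)] by simp
    have "e @ s1 = (u @ [0]) @ s2" using eq m2(1) by simp
    then consider g where "e = (u @ [0]) @ g" | g where "e @ g = u @ [0]" "s1 = g @ s2"
      unfolding append_eq_append_conv2[of e s1 "u @ [0]" s2] by blast
    then obtain g where g: "u @ [0] = e @ g" "s1 = g @ s2"
      by cases (use \<open>0 \<notin> set e\<close> in \<open>auto simp: eq_commute[of "u @ [0]"]\<close>)
    then obtain b where b: "g = b @ [0]" "u = e @ b"
      using \<open>0 \<notin> set e\<close> by (cases g rule: rev_cases) auto
    have "d \<noteq> []"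
    proof
      assume "d = []"
      then have "length e = n" using length_W[OF c1(2)] by simp
      then show False using length_W[OF m2(3)] b m2(6) by simp
    qed
    \<comment> \<open>The relators \<open>d @ e\<close> and \<open>e @ b @ c\<close> overlap in
      \<open>e\<close>; the \<open>c\<close> thus produced then completes the relator
      \<open>c @ v\<close>.\<close>
    then have "rule (d @ [0]) (0 # b @ c)"
      using move[of d e "b @ c"] c1 m2 b \<open>e \<noteq> []\<close> by simp
    from rule_steps[OF this, of "[]" "v @ s2"]
    have "steps (d @ r2 @ s2) (0 # b @ (c @ v) @ s2)" using m2(2) by simp
    also have "steps (0 # b @ (c @ v) @ s2) (0 # b @ [0] @ s2)"
      using rule_steps[OF contract[OF m2(4)], of "0 # b" s2] by simp
    finally show ?thesis using c1 g b by auto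
  qed
next
  case m1: (move u1 c1 v1)
  then obtain e' where e': "e = e' @ [0]" "u1 = d @ e'"
    using \<open>e \<noteq> []\<close> by (cases e rule: rev_cases) auto
  have "0 \<notin> set e'" using zero_notin_W[OF m1(3)] e' by simp
  show ?thesis using r2
  proof (cases rule: rule.cases)
    case c2: contract
    \<comment> \<open>As \<open>e'\<close> is a proper part of a relator, \<open>l2\<close> extends
      past it and would contain the 0.\<close>
    have "length e' < length l2"
      using length_W[OF m1(3)] length_W[OF c2(2)] e' m1(6) by (cases c1) auto
    then have "l2 ! length e' = (l2 @ s2) ! length e'" by (simp add: nth_append)
    also have "\<dots> = 0" using eq e' by (simp add: eq[symmetric])
    finally have "0 \<in> set l2" using \<open>length e' < length l2\<close> by (metis nth_mem)
    then show ?thesis using zero_notin_W[OF c2(2)] by simp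
  next
    case m2: (move u2 c2 v2)
    have "0 \<notin> set u2" using zero_notin_W[OF m2(3)] by simp
    have "e' @ 0 # s1 = u2 @ 0 # s2" using eq e' m2(1) by simp
    then have s: "e' = u2" "s1 = s2"
      using append_Cons_eq_notin \<open>0 \<notin> set e'\<close> \<open>0 \<notin> set u2\<close> by fastforce+
    show ?thesis
    proof (cases "d = []")
      case True
      have "c1 = c2" using append_W_cancel[of u2 c1 c2] m1 m2 e' s True by simp
      then have "v1 = v2" using append_W_cancel[of c1 v1 v2] m1 m2 by simp
      then show ?thesis using m1 m2 True s by auto
    next
      \<comment> \<open>Up to a common rest, the pair is \<open>0 # v1\<close> against
        \<open>d @ 0 # v2\<close>. Extending the overlap \<open>c1\<close> to
        \<open>c2 = c1 @ m\<close> gives both \<open>v1 = m @ v2\<close> and a rule from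
        \<open>d @ [0]\<close> to \<open>0 # m\<close>.\<close>
      case False
      then obtain m where m: "c2 = c1 @ m"
        using shift_prefix[of d u2 c1 v1 c2 v2] m1 m2 e' s by auto
      then have v1: "v1 = m @ v2" using append_W_cancel[of c1 v1 "m @ v2"] m1 m2 by simp
      have "rule (d @ [0]) (0 # m)"
        using move[of d "u2 @ c1" m] m1 m2 e' s m False by simp
      from rule_steps[OF this, of "[]" "v2 @ s2"] show ?thesis
        using m1 m2 s v1 by auto
    qed
  qed
qed

lemma step_locally_confluent:
  assumes "step w a" "step w b"
  shows "\<exists>x. steps a x \<and> steps b x"
proof -
  \<comment> \<open>By symmetry the redex that starts first may be named first. Disjoint redexes are
    reduced independently.\<close>
  have ordered: "\<exists>x. steps (p @ r1 @ s1) x \<and> steps (p @ d @ r2 @ s2) x"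
    if r: "rule l1 r1" "rule l2 r2" and eq: "l1 @ s1 = d @ l2 @ s2" for p l1 r1 s1 d l2 r2 s2
  proof -
    from eq consider g where "d = l1 @ g" "s1 = g @ l2 @ s2"
      | e where "l1 = d @ e" "e \<noteq> []" "e @ s1 = l2 @ s2"
      by (force simp: append_eq_append_conv2)
    then have "\<exists>x. steps (r1 @ s1) x \<and> steps (d @ r2 @ s2) x"
    proof cases
      case 1
      have "steps (r1 @ s1) (r1 @ g @ r2 @ s2)"
        using rule_steps[OF r(2), of "r1 @ g" s2] 1 by simp
      moreover have "steps (d @ r2 @ s2) (r1 @ g @ r2 @ s2)"
        using rule_steps[OF r(1), of "[]" "g @ r2 @ s2"] 1 by simp
      ultimately show ?thesis by blast
    next
      case 2
      then show ?thesis using overlap_joinable r by blast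
    qed
    then obtain x where "steps (r1 @ s1) x" "steps (d @ r2 @ s2) x" by blast
    then show ?thesis
      using steps_append[of "r1 @ s1" x p "[]"] steps_append[of "d @ r2 @ s2" x p "[]"] by auto
  qed
  obtain p1 l1 r1 s1 where 1: "w = p1 @ l1 @ s1" "a = p1 @ r1 @ s1" "rule l1 r1"
    using assms(1) by (auto elim: step.cases)
  obtain p2 l2 r2 s2 where 2: "w = p2 @ l2 @ s2" "b = p2 @ r2 @ s2" "rule l2 r2"
    using assms(2) by (auto elim: step.cases)
  have "p1 @ l1 @ s1 = p2 @ l2 @ s2" using 1 2 by simp
  then consider d where "p2 = p1 @ d" "l1 @ s1 = d @ l2 @ s2"
    | d where "p1 = p2 @ d" "l2 @ s2 = d @ l1 @ s1"
    unfolding append_eq_append_conv2[of p1] by auto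
  then show ?thesis
  proof cases
    case (1 d)
    then show ?thesis using ordered[of l1 r1 l2 r2 s1 d s2 p1] \<open>rule l1 r1\<close> \<open>rule l2 r2\<close>
        \<open>a = _\<close> \<open>b = _\<close> by auto
  next
    case (2 d)
    then show ?thesis using ordered[of l2 r2 l1 r1 s2 d s1 p2] \<open>rule l1 r1\<close> \<open>rule l2 r2\<close>
        \<open>a = _\<close> \<open>b = _\<close> by auto
  qed
qed

text \<open>A letter acts on the measure of the rest of the word by doubling, the letter 0 by the
  successor; so the measure drops when 0 moves to the left.\<close>

primrec weight :: "nat list \<Rightarrow> nat" where
  "weight [] = 1"
| "weight (a # w) = (if a = 0 then Suc (weight w) else 2 * weight w)"

lemma weight_pos: "0 < weight w"
  by (induction w) auto

lemma weight_append_nonzero: "0 \<notin> set u \<Longrightarrow> weight (u @ s) = 2 ^ length u * weight s"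
  by (induction u) auto

lemma weight_append_mono: "weight u < weight v \<Longrightarrow> weight (p @ u) < weight (p @ v)"
  by (induction p) auto

text \<open>With m the weight of the suffix \<open>s\<close>, \<open>contract\<close> lowers the
  weight of the rewritten part from 2^n m to m + 1, and \<open>move\<close> from 2^k (m + 1) to 2^k
  m + 1, where k is the common length of \<open>u\<close> and \<open>v\<close>.\<close>

lemma step_weight: "step w v \<Longrightarrow> weight v < weight w"
proof (induction rule: step.induct)
  case (stepI l r p s)
  have "weight (r @ s) < weight (l @ s)" using stepI
  proof (cases rule: rule.cases)
    case contract
    have "(2::nat) ^ 1 < 2 ^ n" using three_le by (intro power_strict_increasing) auto
    have "weight (r @ s) \<le> 2 * weight s" using contract weight_pos[of s] by simp
    also have "\<dots> < 2 ^ n * weight s"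
      using \<open>(2::nat) ^ 1 < 2 ^ n\<close> weight_pos[of s] by (intro mult_strict_right_mono) auto
    also have "\<dots> = weight (l @ s)"
      using contract by (simp add: weight_append_nonzero zero_notin_W length_W)
    finally show ?thesis .
  next
    case (move u c v)
    have "length u = length v" "0 \<notin> set u" "0 \<notin> set v"
      using length_W[OF move(3)] length_W[OF move(4)]
        zero_notin_W[OF move(3)] zero_notin_W[OF move(4)] by auto
    moreover have "(2::nat) ^ 1 \<le> 2 ^ length u" using move(5)
      by (intro power_increasing) (auto simp: Suc_le_eq)
    ultimately show ?thesis using move by (simp add: weight_append_nonzero)
  qed
  then show ?case by (rule weight_append_mono)
qed

text \<open>Newman's lemma; \<open>weight\<close> drops along \<open>step\<close> and thereby
  carries the induction.\<close>

lemma step_confluent: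
  assumes "steps w a" "steps w b"
  shows "\<exists>x. steps a x \<and> steps b x"
  using assms
proof (induction "weight w" arbitrary: w a b rule: less_induct)
  case less
  show ?case
  proof (cases "w = a \<or> w = b")
    case True
    then show ?thesis using less.prems by auto
  next
    case False
    obtain a' where a': "step w a'" "steps a' a"
      by (rule converse_rtranclpE[OF less.prems(1)]) (use False in auto)
    obtain b' where b': "step w b'" "steps b' b"
      by (rule converse_rtranclpE[OF less.prems(2)]) (use False in auto)
    obtain x where x: "steps a' x" "steps b' x"
      using step_locally_confluent[OF a'(1) b'(1)] by blast
    obtain y where y: "steps a y" "steps x y"
      using less.hyps[OF step_weight[OF a'(1)] a'(2) x(1)] by blast
    obtain z where "steps b z" "steps y z"
      using less.hyps[OF step_weight[OF b'(1)] b'(2) rtranclp_trans[OF x(2) y(2)]] by blast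
    then show ?thesis using rtranclp_trans[OF y(1)] by blast
  qed
qed

section \<open>Normal forms and the quantities that control them\<close>

definition nf :: "nat list \<Rightarrow> nat list" where
  "nf w = (SOME v. steps w v \<and> irr v)"

lemma ex_irr: "\<exists>v. steps w v \<and> irr v"
proof (induction "weight w" arbitrary: w rule: less_induct)
  case less
  show ?case
  proof (cases "irr w")
    case False
    then obtain v where v: "step w v" by (auto simp: irr_def)
    then show ?thesis using less[OF step_weight[OF v]]
      by (blast intro: converse_rtranclp_into_rtranclp)
  qed auto
qed

lemma steps_nf: "steps w (nf w)" and irr_nf: "irr (nf w)"
  using someI_ex[OF ex_irr[of w]] by (auto simp: nf_def)

lemma irr_steps: "irr w \<Longrightarrow> steps w v \<Longrightarrow> v = w"
  unfolding irr_def by (erule converse_rtranclpE) auto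

lemma nf_unique:
  assumes "steps w v" "irr v"
  shows "nf w = v"
proof -
  obtain x where "steps v x" "steps (nf w) x"
    using step_confluent[OF assms(1) steps_nf] by blast
  then have "x = v" "x = nf w"
    by (blast intro: irr_steps assms(2) irr_nf)+
  then show ?thesis by simp
qed

lemma nf_eqI: "steps u v \<Longrightarrow> nf u = nf v"
  using nf_unique[OF rtranclp_trans[OF _ steps_nf] irr_nf] .

lemma nf_irr: "irr w \<Longrightarrow> nf w = w"
  by (rule nf_unique[OF rtranclp.rtrancl_refl])

lemma steps_append2: "steps u u' \<Longrightarrow> steps v v' \<Longrightarrow> steps (u @ v) (u' @ v')"
  using steps_append[of u u' "[]" v] steps_append[of v v' u' "[]"] by (auto intro: rtranclp_trans)

text \<open>The letter 0 counts as \<open>n\<close> because it stands for words of length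
  \<open>n\<close>; this makes \<open>deg\<close> invariant under reduction.\<close>

definition deg :: "nat list \<Rightarrow> nat" where
  "deg w = sum_list (map (\<lambda>a. if a = 0 then n else 1) w)"

lemma deg_simps [simp]: "deg [] = 0" "deg (a # w) = (if a = 0 then n else 1) + deg w"
  "deg (u @ v) = deg u + deg v"
  by (simp_all add: deg_def)

lemma deg_nonzero: "0 \<notin> set w \<Longrightarrow> deg w = length w"
  by (induction w) auto

lemma deg_eq_0: "deg w = 0 \<longleftrightarrow> w = []"
  using three_le by (cases w) auto

lemma rule_deg: "rule l r \<Longrightarrow> deg l = deg r"
proof (induction rule: rule.induct)
  case (contract w)
  then show ?case using length_W[of w] zero_notin_W[of w] by (simp add: deg_nonzero)
next
  case (move u c v)
  then show ?case using length_W[OF move(1)] length_W[OF move(2)]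
      zero_notin_W[OF move(1)] zero_notin_W[OF move(2)] by (simp add: deg_nonzero)
qed

lemma steps_deg: "steps u v \<Longrightarrow> deg u = deg v"
proof (induction rule: rtranclp_induct)
  case (step v w)
  then obtain p l r s where "rule l r" "v = p @ l @ s" "w = p @ r @ s"
    by (auto elim!: step.cases)
  then show ?case using rule_deg[of l r] step by simp
qed simp

text \<open>Nonempty words have positive degree, so the degree of a prefix fixes the cut. Lengths
  would not do, since \<open>contract\<close> changes them.\<close>

lemma append_eq_deg:
  assumes "p @ r = p' @ r'" "deg p = deg p'"
  shows "p = p' \<and> r = r'"
proof -
  from assms(1) consider g where "p = p' @ g" "g @ r = r'" | g where "p @ g = p'" "r = g @ r'"
    unfolding append_eq_append_conv2[of p] by blast
  then show ?thesis
  proof cases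
    case (1 g)
    then have "g = []" using assms(2) deg_eq_0[of g] by simp
    then show ?thesis using 1 by simp
  next
    case (2 g)
    then have "deg p = deg p + deg g" using assms(2) by auto
    then have "g = []" using deg_eq_0[of g] by simp
    then show ?thesis using 2 by simp
  qed
qed

abbreviation zeros :: "nat list \<Rightarrow> nat" where "zeros w \<equiv> count_list w 0"

text \<open>The disjunction separates the two rules: a reduction that keeps the number of 0s must
  use a left side containing 0.\<close>

lemma rule_zeros: "rule l r \<Longrightarrow> 0 \<notin> set l \<and> zeros r = Suc (zeros l) \<or> 0 \<in> set l \<and> zeros r = zeros l"
proof (induction rule: rule.induct)
  case (contract w)
  then show ?case using zero_notin_W by (simp add: count_list_0_iff)
next
  case (move u c v)
  then show ?case using zero_notin_W[OF move(1)] zero_notin_W[OF move(2)]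
    by (simp add: count_list_0_iff)
qed

lemma steps_zeros: "steps u v \<Longrightarrow> zeros u \<le> zeros v"
proof (induction rule: rtranclp_induct)
  case (step v w)
  then obtain p l r s where "rule l r" "v = p @ l @ s" "w = p @ r @ s"
    by (auto elim!: step.cases)
  then show ?case using rule_zeros[of l r] step by auto
qed simp

lemma zeros_nf: "zeros w \<le> zeros (nf w)"
  by (rule steps_zeros[OF steps_nf])

lemma rule_set: "rule l r \<Longrightarrow> set r \<subseteq> {0..n}"
proof (induction rule: rule.induct)
  case (move u c v)
  then show ?case using set_W[OF move(2)] by auto
qed auto

lemma steps_set: "steps u v \<Longrightarrow> set u \<subseteq> {0..n} \<Longrightarrow> set v \<subseteq> {0..n}"
proof (induction rule: rtranclp_induct)
  case (step v w)
  then obtain p l r s where "rule l r" "v = p @ l @ s" "w = p @ r @ s"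
    by (auto elim!: step.cases)
  then show ?case using rule_set[of l r] step by simp
qed

section \<open>Extending irreducible words by letters\<close>

lemma irr_factor: "irr (p @ w @ s) \<Longrightarrow> irr w"
  unfolding irr_def using step_append by blast

text \<open>Left sides of rules have distinct letters, so a redex cannot contain both copies of
  \<open>a\<close>; it would lie in \<open>p @ [a]\<close> or in \<open>[a] @ s\<close>.\<close>

lemma irr_double:
  assumes "irr (p @ [a])" "irr ([a] @ s)"
  shows "irr (p @ [a, a] @ s)"
  unfolding irr_def
proof (intro allI notI)
  fix v assume "step (p @ [a, a] @ s) v"
  then obtain q l r t where l: "rule l r" and "q @ l @ t = p @ [a, a] @ s"
    by (auto elim!: step.cases)
  from this(2) rule_distinct[OF l] show False
  proof (cases rule: distinct_factor_cases)
    case (left x)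
    then show False using assms(1) stepI[OF l, of q x] by (auto simp: irr_def)
  next
    case (right x)
    then show False using assms(2) stepI[OF l, of x t] by (auto simp: irr_def)
  qed
qed

lemma irr_short:
  assumes "0 \<notin> set w" "length w \<le> 2"
  shows "irr w"
  unfolding irr_def
proof (intro allI notI)
  fix v assume "step w v"
  then obtain p l r s where "rule l r" "w = p @ l @ s" by (auto elim!: step.cases)
  then show False using assms three_le length_W[of l] by (auto elim!: rule.cases)
qed

lemma irr_double_hd: "a \<noteq> 0 \<Longrightarrow> irr (a # s) \<Longrightarrow> irr (a # a # s)"
  using irr_double[of "[]" a s] irr_short[of "[a]"] by simp

lemma irr_join:
  assumes "irr (t @ [x])" "irr (y # g)" "x \<noteq> 0" "y \<noteq> 0"
  shows "irr (t @ [x, x, y, y] @ g)"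
proof -
  have "irr ([x] @ [y, y] @ g)"
    using assms by (intro irr_double) (auto intro: irr_short)
  then show ?thesis using irr_double[OF assms(1), of "[y, y] @ g"] by simp
qed

text \<open>A redex not ending at the new letter would already lie in \<open>t\<close>. As
  \<open>x\<close> is not 0, it is no left side of \<open>move\<close>, so it is a relator.\<close>

lemma irr_snoc_reducible:
  assumes "irr t" "\<not> irr (t @ [x])" "x \<noteq> 0"
  obtains p w where "w \<in> W" "t @ [x] = p @ w" "step (t @ [x]) (p @ [0])"
proof -
  obtain v where "step (t @ [x]) v" using assms(2) by (auto simp: irr_def)
  then obtain p l r s where l: "rule l r" "t @ [x] = p @ l @ s" by (auto elim!: step.cases)
  have "s = []"
  proof (cases s rule: rev_cases)
    case (snoc s' a)
    then have "t = p @ l @ s'" using l(2) by simp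
    then show ?thesis using assms(1) stepI[OF l(1), of p s'] by (auto simp: irr_def)
  qed
  then show thesis using l that assms(3) stepI[OF l(1), of p "[]"] rule_hd(1)[OF l(1)]
    by (auto elim!: rule.cases)
qed

text \<open>If both letters completed a relator, the two relators would share their first n - 1
  letters and so coincide.\<close>

lemma irr_snoc_exists:
  assumes "irr t"
  shows "\<exists>x\<in>{1, 2}. irr (t @ [x])"
proof (rule ccontr)
  assume "\<not> ?thesis"
  then have no: "\<not> irr (t @ [1])" "\<not> irr (t @ [2])" by auto
  obtain p w where 1: "w \<in> W" "t @ [1] = p @ w"
    using irr_snoc_reducible[OF assms no(1)] by (metis one_neq_zero)
  obtain p' w' where 2: "w' \<in> W" "t @ [2] = p' @ w'"
    using irr_snoc_reducible[OF assms no(2)] by (metis zero_neq_numeral)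
  obtain v where v: "w = v @ [1]" "t = p @ v"
    using 1 length_W[OF 1(1)] three_le by (cases w rule: rev_cases) auto
  obtain v' where v': "w' = v' @ [2]" "t = p' @ v'"
    using 2 length_W[OF 2(1)] three_le by (cases w' rule: rev_cases) auto
  have "length v = length v'" "v \<noteq> []"
    using length_W[OF 1(1)] length_W[OF 2(1)] v v' three_le by auto
  then have "v = v'" using v v' by simp
  then show False using append_W_cancel[of v "[1]" "[2]"] 1 2 v v' \<open>v \<noteq> []\<close> by simp
qed

lemma irr_Cons_reducible:
  assumes "irr f" "\<not> irr (y # f)"
  obtains l r s where "rule l r" "y # f = l @ s"
proof -
  obtain v where "step (y # f) v" using assms(2) by (auto simp: irr_def)
  then obtain p l r s where l: "rule l r" "y # f = p @ l @ s" by (auto elim!: step.cases)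
  have "p = []"
  proof (cases p)
    case (Cons a p')
    then have "f = p' @ l @ s" using l(2) by simp
    then show ?thesis using assms(1) stepI[OF l(1), of p' s] by (auto simp: irr_def)
  qed
  then show thesis using l that by simp
qed

text \<open>All relators use the same letters, so the single letter missing from \<open>c\<close> is
  \<open>y\<close>. Thus a rule pushing 0 past one letter only comes from a rotation by one
  letter.\<close>

lemma W_rotate:
  assumes "y # c \<in> W" "c @ v \<in> W"
  shows "c @ [y] \<in> W"
proof -
  have "length v = 1" using length_W[OF assms(1)] length_W[OF assms(2)] by simp
  then obtain a where a: "v = [a]" by (cases v) auto
  have "a \<in> set (y # c)" using set_W[OF assms(1)] set_W[OF assms(2)] a by auto
  moreover have "a \<notin> set c" using distinct_W[OF assms(2)] a by simp
  ultimately show ?thesis using assms(2) a by simp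
qed

text \<open>A redex at the front of \<open>y # f\<close> with at least two nonzero letters makes
  \<open>hd f\<close> the second letter of a relator starting with \<open>y\<close>; by
  \<open>nth_inject\<close> this happens for one \<open>y\<close> only. The exception is the redex
  \<open>[y, 0]\<close>, which the second hypothesis excludes.\<close>

lemma irr_Cons_exists:
  assumes "irr f" and f: "(\<forall>a c. a # c \<in> W \<longrightarrow> c @ [a] \<notin> W) \<or> 0 \<notin> set f"
  shows "\<exists>y\<in>{1, 2}. irr (y # f)"
proof (rule ccontr)
  assume "\<not> ?thesis"
  then have no: "\<not> irr (1 # f)" "\<not> irr (2 # f)" by auto
  have ex: "\<exists>b f' c. f = b # f' \<and> y # b # c \<in> W" if not_irr: "\<not> irr (y # f)" and "y \<noteq> 0" for y
  proof -
    obtain l r s where l: "rule l r" "y # f = l @ s"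
      using irr_Cons_reducible[OF assms(1) not_irr] by blast
    from l(1) show ?thesis
    proof (cases rule: rule.cases)
      case contract
      then obtain a b c where "l = a # b # c" 
        using length_W[of l] three_le by (cases l; cases "tl l") auto
      then show ?thesis using l contract by auto
    next
      case (move u c v)
      then obtain u' where u: "u = y # u'" using l by (cases u) auto
      show ?thesis
      proof (cases u')
        case Nil
        then have f0: "0 \<in> set f" using u l move by auto
        have "y # c \<in> W" using Nil u move by simp
        then show ?thesis using f f0 W_rotate move(4) by blast
      next
        case (Cons b u'')
        then show ?thesis using u l move by auto
      qed
    qed
  qed
  obtain b f' c where 1: "f = b # f'" "1 # b # c \<in> W" using ex[OF no(1)] by auto
  obtain c' where 2: "2 # b # c' \<in> W" using ex[OF no(2)] 1 by auto
  show False using nth_inject[OF 1(2) 2, of 1] three_le by simp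
qed

lemma steps_hd_0: "steps (0 # u) v \<Longrightarrow> \<exists>v'. v = 0 # v'"
proof (induction rule: rtranclp_induct)
  case (step v w)
  then obtain v' p l r s where "v = 0 # v'" "rule l r" "v = p @ l @ s" "w = p @ r @ s"
    by (auto elim!: step.cases)
  then show ?case using rule_hd(1)[of l r] by (cases p) auto
qed auto

lemma nf_Cons_reducible:
  assumes "irr f" "\<not> irr (y # f)"
  shows "\<exists>v. nf (y # f) = 0 # v"
proof -
  obtain l r s where l: "rule l r" "y # f = l @ s"
    using irr_Cons_reducible[OF assms] by blast
  then have "nf (y # f) = nf (r @ s)" using rule_steps[OF l(1), of "[]" s] by (simp add: nf_eqI)
  then show ?thesis using rule_hd(2)[OF l(1)] steps_hd_0 steps_nf by fastforce
qed

section \<open>Uniquely attained products\<close>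

definition separators :: "nat list set" where
  "separators = (\<lambda>(x, y). [x, x, y, y, y]) ` ({1, 2} \<times> {1, 2})"

text \<open>A competing product t'x'x'y'y'y'f' has the same number of letters 0, so t'x' is irreducible too;
  and even if y'f' reduces, its normal form starts with 0 and is blocked by the second y'.\<close>

lemma unique_product_acyclic:
  assumes acyclic: "\<forall>a c. a # c \<in> W \<longrightarrow> c @ [a] \<notin> W"
    and irr: "irr t" "irr f" "irr (t @ [x])" "irr (y # f)" "irr t'" "irr f'"
    and deg: "deg t = deg t'"
    and zeros: "zeros t \<le> zeros t'" "zeros f \<le> zeros f'"
    and nz: "x \<noteq> 0" "y \<noteq> 0" "x' \<noteq> 0" "y' \<noteq> 0"
    and eq: "nf (t @ [x, x, y, y, y] @ f) = nf (t' @ [x', x', y', y', y'] @ f')"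
  shows "t = t' \<and> x = x' \<and> y = y' \<and> f = f'"
proof -
  have irr_R: "irr (t @ [x, x, y, y] @ (y # f))"
    using irr nz by (intro irr_join irr_double_hd)
  define R where "R = t @ [x, x, y, y] @ (y # f)"
  define g where "g = nf (y' # f')"
  \<comment> \<open>Only the last \<open>y'\<close> is absorbed into \<open>g\<close>; the two left
    in front of it are the barrier.\<close>
  define X where "X = t' @ [x', x', y', y'] @ g"
  have nf_X: "nf X = R"
  proof -
    have "steps (t' @ [x', x', y', y', y'] @ f') X"
      using steps_append[OF steps_nf[of "y' # f'"], of "t' @ [x', x', y', y']" "[]"]
      by (simp add: X_def g_def)
    then have "nf X = nf (t @ [x, x, y, y, y] @ f)" using eq nf_eqI by simp
    also have "\<dots> = R" using nf_irr[OF irr_R] by (simp add: R_def)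
    finally show ?thesis .
  qed
  have zg: "zeros f' \<le> zeros g" using zeros_nf[of "y' # f'"] nz by (simp add: g_def)
  \<comment> \<open>Otherwise \<open>t' @ [x']\<close> ends in a relator, whose contraction leaves
    more 0s than \<open>R\<close> has, while reduction to \<open>R\<close> cannot remove
    any.\<close>
  have irr_x': "irr (t' @ [x'])"
  proof (rule ccontr)
    assume "\<not> irr (t' @ [x'])"
    then obtain p w where w: "w \<in> W" "t' @ [x'] = p @ w" "step (t' @ [x']) (p @ [0])"
      using irr_snoc_reducible irr nz by metis
    have "zeros (t' @ [x']) = zeros p"
      using w zero_notin_W[OF w(1)] by (simp add: count_list_0_iff)
    then have "zeros p = zeros t'" using nz by simp
    have "nf X = nf (p @ [0] @ [x', y', y'] @ g)"
      using step_append[OF w(3), of "[]" "[x', y', y'] @ g"]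
      by (intro nf_eqI) (simp add: X_def r_into_rtranclp)
    then have "zeros (p @ [0] @ [x', y', y'] @ g) \<le> zeros R"
      using nf_X zeros_nf by metis
    then show False using \<open>zeros p = zeros t'\<close> zg zeros nz by (simp add: R_def)
  qed
  have irr_y'g: "irr (y' # g)"
  proof (cases "irr (y' # f')")
    case True
    then show ?thesis using irr_double_hd nz by (simp add: g_def nf_irr)
  next
    case False
    then obtain v where v: "g = 0 # v" using nf_Cons_reducible irr by (auto simp: g_def)
    show ?thesis
    proof (rule ccontr)
      assume not_irr: "\<not> irr (y' # g)"
      have "irr g" by (simp add: g_def irr_nf)
      then obtain l r s where l: "rule l r" "y' # 0 # v = l @ s"
        using irr_Cons_reducible[OF _ not_irr] v by auto
      from l(1) show False
      proof (cases rule: rule.cases)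
        case contract
        then obtain a b c where "l = a # b # c" 
          using length_W[of l] three_le by (cases l; cases "tl l") auto
        then show False using l contract zero_notin_W[of l] by auto
      next
        \<comment> \<open>The left side would be \<open>[y', 0]\<close>, because the letters before
          its final 0 are nonzero; this needs a rotation, which \<open>acyclic\<close>
          excludes.\<close>
        case (move u c w)
        then obtain u' where u: "u = y' # u'" using l by (cases u) auto
        have "u' = []" using l u move(1) zero_notin_W[OF move(3)] by (cases u') auto
        then have c: "y' # c \<in> W" using u move(3) by simp
        then show False using acyclic W_rotate move(4) by blast
      qed
    qed
  qed
  have "X = R"
    using nf_irr[of X] irr_join[OF irr_x' irr_y'g nz(3,4)] nf_X by (simp add: X_def)
  then have "(t' @ [x', x', y', y']) @ g = (t @ [x, x, y, y]) @ (y # f)"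
    by (simp add: X_def R_def)
  from append_eq_deg[OF this]
  have e: "t' @ [x', x', y', y'] = t @ [x, x, y, y]" "g = y # f"
    using deg nz by auto
  then have e': "t' = t" "x' = x" "y' = y" by auto
  \<comment> \<open>The head \<open>y\<close> of \<open>g\<close> is not 0, so
    \<open>y' # f'\<close> cannot have been reduced.\<close>
  have "irr (y' # f')"
    using nf_Cons_reducible[of f' y'] irr(6) e(2) nz by (auto simp: g_def)
  then have "g = y' # f'" by (simp add: g_def nf_irr)
  then show ?thesis using e e' by simp
qed

text \<open>The relators \<open>b # d\<close> and \<open>d @ [b]\<close> overlap in
  \<open>d\<close>, so \<open>move\<close> applies with \<open>u = v = [b]\<close>.\<close>

lemma cyclic_swap:
  assumes "a # c \<in> W" "c @ [a] \<in> W" "b \<in> {1..n}"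
  shows "rule [b, 0] [0, b]"
proof -
  obtain d where "b # d \<in> W" "d @ [b] \<in> W" using rotate_all[OF assms] by blast
  moreover from this have "d \<noteq> []" using length_W[of "b # d"] three_le by auto
  ultimately show ?thesis using move[of "[b]" d "[b]"] by simp
qed

text \<open>By \<open>cyclic_swap\<close> a nonzero letter directly before a 0 is a redex, so all 0s
  stand in front. The last clause gives the rest as a term in \<open>w\<close> alone, the form in
  which it enters the choice of \<open>y\<close>.\<close>

lemma cyclic_irr_split:
  assumes cyc: "a # c \<in> W" "c @ [a] \<in> W" and "irr w" "set w \<subseteq> {0..n}"
  obtains u where "w = replicate (zeros w) 0 @ u" "0 \<notin> set u" "u = dropWhile (\<lambda>a. a = 0) w"
proof -
  have "\<exists>u. w = replicate (zeros w) 0 @ u \<and> 0 \<notin> set u \<and> u = dropWhile (\<lambda>a. a = 0) w"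
    using assms(3,4)
  proof (induction w)
    case (Cons b w)
    have "irr w" using Cons.prems(1) irr_factor[of "[b]" w "[]"] by simp
    then obtain u where u: "w = replicate (zeros w) 0 @ u" "0 \<notin> set u" "u = dropWhile (\<lambda>a. a = 0) w"
      using Cons by (auto simp del: dropWhile.simps)
    show ?case
    proof (cases "b = 0")
      case True
      then show ?thesis using u by auto
    next
      case False
      have "zeros w = 0"
      proof (rule ccontr)
        assume "zeros w \<noteq> 0"
        then obtain k where "zeros w = Suc k" using not0_implies_Suc by blast
        then have "w = 0 # replicate k 0 @ u" using u(1) by simp
        then have "step (b # w) ([] @ [0, b] @ replicate k 0 @ u)"
          using stepI[OF cyclic_swap[OF cyc, of b], of "[]" "replicate k 0 @ u"] False Cons.prems(2) by simp
        then show False using Cons.prems(1) by (auto simp: irr_def)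
      qed
      then show ?thesis using False u by auto
    qed
  qed simp
  then show thesis using that by blast
qed

text \<open>Here 0 commutes with every letter, so a normal form is a power of 0 times a word without 0.\<close>

lemma unique_product_cyclic:
  assumes "a # c \<in> W" "c @ [a] \<in> W"
    and irr: "irr t" "irr f" "irr (t @ [x])" "irr (y # dropWhile (\<lambda>a. a = 0) f)" "irr t'" "irr f'"
    and set: "set t \<subseteq> {0..n}" "set f \<subseteq> {0..n}" "set t' \<subseteq> {0..n}" "set f' \<subseteq> {0..n}"
    and deg: "deg t = deg t'"
    and zeros: "zeros t \<le> zeros t'" "zeros f \<le> zeros f'"
    and nz: "x \<in> {1..n}" "y \<in> {1..n}" "x' \<in> {1..n}" "y' \<in> {1..n}"
    and eq: "nf (t @ [x, x, y, y, y] @ f) = nf (t' @ [x', x', y', y', y'] @ f')"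
  shows "t = t' \<and> x = x' \<and> y = y' \<and> f = f'"
proof -
  note swap = cyclic_swap[OF assms(1,2)]
  have swaps: "steps (u @ replicate k 0 @ s) (replicate k 0 @ u @ s)"
    if "set u \<subseteq> {0..n}" for u k s
  proof -
    have 1: "steps (b # replicate k 0 @ s) (replicate k 0 @ b # s)" if b: "b \<in> {0..n}" for b s
    proof (induction k)
      case (Suc k)
      show ?case
      proof (cases "b = 0")
        case True
        then show ?thesis by (simp add: replicate_app_Cons_same)
      next
        case False
        then have "steps (b # 0 # replicate k 0 @ s) (0 # b # replicate k 0 @ s)"
          using rule_steps[OF swap[of b], of "[]"] b by simp
        also have "steps (0 # b # replicate k 0 @ s) (0 # replicate k 0 @ b # s)"
          using steps_append[OF Suc, of "[0]" "[]"] by simp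
        finally show ?thesis by simp
      qed
    qed simp
    show ?thesis using that
    proof (induction u)
      case (Cons b u)
      have "steps (b # u @ replicate k 0 @ s) (b # replicate k 0 @ u @ s)"
        using steps_append[OF Cons.IH, of "[b]" "[]"] Cons.prems by simp
      also have "steps (b # replicate k 0 @ u @ s) (replicate k 0 @ b # u @ s)"
        using 1 Cons.prems by simp
      finally show ?case by simp
    qed simp
  qed
  obtain w where w: "t = replicate (zeros t) 0 @ w" "0 \<notin> set w"
    using cyclic_irr_split[OF assms(1,2) irr(1) set(1)] by blast
  obtain v where v: "f = replicate (zeros f) 0 @ v" "0 \<notin> set v" "v = dropWhile (\<lambda>a. a = 0) f"
    using cyclic_irr_split[OF assms(1,2) irr(2) set(2)] by blast
  obtain w' where w': "t' = replicate (zeros t') 0 @ w'" "0 \<notin> set w'"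
    using cyclic_irr_split[OF assms(1,2) irr(5) set(3)] by blast
  obtain v' where v': "f' = replicate (zeros f') 0 @ v'" "0 \<notin> set v'"
    using cyclic_irr_split[OF assms(1,2) irr(6) set(4)] by blast
  \<comment> \<open>No left side starts with 0.\<close>
  have irr_zeros: "irr (replicate k 0 @ u)" if "irr u" for k u
  proof (induction k)
    case (Suc k)
    show ?case
    proof (rule ccontr)
      assume "\<not> irr (replicate (Suc k) 0 @ u)"
      then obtain l r s where "rule l r" "0 # replicate k 0 @ u = l @ s"
        using irr_Cons_reducible[OF Suc] by (metis append_Cons replicate_Suc)
      then show False using rule_hd(1)[of l r] by auto
    qed
  qed (use that in simp)
  define R where "R = replicate (zeros t + zeros f) 0 @ w @ [x, x, y, y, y] @ v"
  define X where "X = replicate (zeros t' + zeros f') 0 @ w' @ [x', x', y', y', y'] @ v'"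
  have move: "steps (t1 @ q @ f1) (replicate (zeros t1 + zeros f1) 0 @ u @ q @ s)"
    if "t1 = replicate (zeros t1) 0 @ u" "f1 = replicate (zeros f1) 0 @ s" "set (u @ q) \<subseteq> {0..n}"
    for t1 f1 u s q
  proof -
    have "steps (replicate (zeros t1) 0 @ (u @ q) @ replicate (zeros f1) 0 @ s)
        (replicate (zeros t1) 0 @ replicate (zeros f1) 0 @ (u @ q) @ s)"
      using steps_append[OF swaps[OF that(3), of "zeros f1" s], of "replicate (zeros t1) 0" "[]"] by simp
    then show ?thesis using that(1,2) by (metis append_assoc replicate_add)
  qed
  have "irr R"
  proof -
    have "irr ((replicate (zeros t) 0 @ w) @ [x])" unfolding w(1)[symmetric] by (rule irr(3))
    then have "irr (w @ [x])" using irr_factor[of "replicate (zeros t) 0" "w @ [x]" "[]"] by simp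
    moreover have "irr (y # y # v)" using irr(4) v nz by (auto intro: irr_double_hd)
    ultimately have "irr (w @ [x, x, y, y] @ (y # v))" using nz by (intro irr_join) auto
    then show ?thesis unfolding R_def using irr_zeros by simp
  qed
  have "set (replicate (zeros t) 0 @ w) \<subseteq> {0..n}" "set (replicate (zeros t') 0 @ w') \<subseteq> {0..n}"
    unfolding w(1)[symmetric] w'(1)[symmetric] by (rule set)+
  then have "set (w @ [x, x, y, y, y]) \<subseteq> {0..n}" "set (w' @ [x', x', y', y', y']) \<subseteq> {0..n}"
    using nz by auto
  note moves = move[OF w(1) v(1) this(1)] move[OF w'(1) v'(1) this(2)]
  have "steps (t @ [x, x, y, y, y] @ f) R"
    using moves(1) by (simp add: R_def)
  then have "nf (t @ [x, x, y, y, y] @ f) = R" using nf_unique \<open>irr R\<close> by blast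
  moreover have "steps (t' @ [x', x', y', y', y'] @ f') X"
    using moves(2) by (simp add: X_def)
  ultimately have nf_X: "nf X = R" using eq nf_eqI by metis
  have zeros_replicate: "zeros (replicate k 0) = k" for k by (induction k) auto
  have zeros_R: "zeros R = zeros t + zeros f"
    using w(2) v(2) nz by (auto simp: R_def zeros_replicate count_list_0_iff)
  have zeros_X: "zeros X = zeros t' + zeros f'"
    using w'(2) v'(2) nz by (auto simp: X_def zeros_replicate count_list_0_iff)
  have zz: "zeros t' = zeros t" "zeros f' = zeros f"
    using zeros_nf[of X] nf_X zeros_R zeros_X zeros by auto
  \<comment> \<open>A reduction of \<open>X\<close> cannot create a 0, since \<open>R\<close> has no
    more of them than \<open>X\<close>; so it moves a 0 past nonzero letters on its left. But in
    \<open>X\<close> all 0s come first.\<close>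
  have "irr X"
  proof (rule ccontr)
    assume "\<not> irr X"
    then obtain p l r s where l: "rule l r" "X = p @ l @ s" by (auto simp: irr_def elim!: step.cases)
    have "zeros (p @ r @ s) \<le> zeros R"
      using nf_X nf_eqI[OF rule_steps[OF l(1), of p s]] l(2) zeros_nf by metis
    then have "\<not> zeros r = Suc (zeros l)"
      using l(2) zeros_X zeros_R zz by auto
    then have "0 \<in> set l" using rule_zeros[OF l(1)] by auto
    from l(1) obtain u where u: "l = u @ [0]" "u \<noteq> []" "0 \<notin> set u"
    proof (cases rule: rule.cases)
      case contract
      then show thesis using zero_notin_W[of l] \<open>0 \<in> set l\<close> by simp
    next
      case (move u c v)
      then show thesis using that[of u] zero_notin_W[OF move(3)] by simp
    qed
    define Y where "Y = w' @ [x', x', y', y', y'] @ v'"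
    have "0 \<notin> set Y" using w' v' nz by (auto simp: Y_def)
    have "(p @ u) @ [0] @ s = replicate (zeros t' + zeros f') 0 @ Y"
      using l(2) u by (simp add: X_def Y_def)
    then consider g where "g @ [0] @ s = Y" | g where "(p @ u) @ g = replicate (zeros t' + zeros f') 0"
      unfolding append_eq_append_conv2[of "p @ u" "[0] @ s"] by blast
    then have "set u \<subseteq> {0}"
    proof cases
      case 1
      then show ?thesis using \<open>0 \<notin> set Y\<close> by auto
    next
      case 2
      then have "set u \<subseteq> set (replicate (zeros t' + zeros f') (0::nat))"
        by (metis Un_subset_iff order_refl set_append)
      then show ?thesis by (auto split: if_splits)
    qed
    then show False using u by (cases u) auto
  qed
  then have "X = R" using nf_X nf_irr by simp
  then have e: "w' @ [x', x', y', y', y'] @ v' = w @ [x, x, y, y, y] @ v"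
    using zz by (simp add: X_def R_def)
  \<comment> \<open>With equal numbers of 0s, equal degrees give equal lengths, which cut both sides
    of \<open>e\<close> at the same places.\<close>
  have "deg t = n * zeros t + length w" "deg t' = n * zeros t' + length w'"
  proof -
    have d: "deg (replicate k 0) = n * k" for k by (induction k) auto
    show "deg t = n * zeros t + length w"
      by (subst w(1)) (simp add: d deg_nonzero[OF w(2)] del: replicate.simps)
    show "deg t' = n * zeros t' + length w'"
      by (subst w'(1)) (simp add: d deg_nonzero[OF w'(2)])
  qed
  then have "length w = length w'" using deg zz by simp
  then have "w' = w \<and> x' = x \<and> y' = y \<and> v' = v" using e by simp
  note same = this
  have "t = t'" by (subst w(1), subst w'(1)) (simp add: zz same)
  moreover have "f = f'" by (subst v(1), subst v'(1)) (simp add: zz same)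
  ultimately show ?thesis using same by simp
qed

text \<open>The minima over \<open>T\<close> and over \<open>F\<close> are taken separately, and
  \<open>x\<close> and \<open>y\<close> are then fitted to them. Constant length on \<open>T\<close>
  gives its normal forms a common degree, as needed to cut the products.\<close>

theorem unique_product:
  assumes T: "finite T" "T \<noteq> {}" "\<forall>t\<in>T. set t \<subseteq> {1..n} \<and> length t = i"
    and F: "finite F" "F \<noteq> {}" "\<forall>f\<in>F. set f \<subseteq> {1..n} \<and> length f = j"
  shows "\<exists>t\<in>T. \<exists>q\<in>separators. \<exists>f\<in>F. \<forall>t'\<in>T. \<forall>q'\<in>separators. \<forall>f'\<in>F.
    nf (t @ q @ f) = nf (t' @ q' @ f') \<longrightarrow> nf t' = nf t \<and> q' = q \<and> nf f' = nf f"
proof -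
  define t where "t = arg_min_on (\<lambda>t. zeros (nf t)) T"
  define f where "f = arg_min_on (\<lambda>t. zeros (nf t)) F"
  have t: "t \<in> T" "zeros (nf t) \<le> zeros (nf t')" if "t' \<in> T" for t'
    using arg_min_if_finite(1)[OF T(1,2)] arg_min_least[OF T(1,2) that] by (auto simp: t_def)
  have f: "f \<in> F" "zeros (nf f) \<le> zeros (nf f')" if "f' \<in> F" for f'
    using arg_min_if_finite(1)[OF F(1,2)] arg_min_least[OF F(1,2) that] by (auto simp: f_def)
  have tf: "t \<in> T" "f \<in> F" using t f T(2) F(2) by auto
  have deg_nf: "deg (nf t') = i" if "t' \<in> T" for t'
  proof -
    have "deg (nf t') = deg t'" using steps_deg[OF steps_nf[of t']] by simp
    also have "\<dots> = i" using T(3) that deg_nonzero[of t'] by fastforce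
    finally show ?thesis .
  qed
  have set_nf: "set (nf t') \<subseteq> {0..n}" if "t' \<in> T \<union> F" for t'
    using steps_set[OF steps_nf[of t']] T(3) F(3) that by fastforce
  have nf_prod: "nf (t' @ q @ f') = nf (nf t' @ q @ nf f')" for t' q f'
    by (intro nf_eqI steps_append2 steps_nf) simp
  obtain x where x: "x \<in> {1, 2}" "irr (nf t @ [x])" using irr_snoc_exists irr_nf by blast
  have eq': "nf (nf t @ q @ nf f) = nf (nf t' @ q' @ nf f')"
    if "nf (t @ q @ f) = nf (t' @ q' @ f')" for q t' q' f'
    using that unfolding nf_prod[symmetric] .
  obtain y where y: "y \<in> {1, 2}" and
    unique: "\<And>t' f' x' y'. \<lbrakk>t' \<in> T; f' \<in> F; x' \<in> {1, 2}; y' \<in> {1, 2};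
      nf (t @ [x, x, y, y, y] @ f) = nf (t' @ [x', x', y', y', y'] @ f')\<rbrakk> \<Longrightarrow>
      nf t = nf t' \<and> x = x' \<and> y = y' \<and> nf f = nf f'"
  proof (cases "\<forall>a c. a # c \<in> W \<longrightarrow> c @ [a] \<notin> W")
    case acyclic: True
    then obtain y where y: "y \<in> {1, 2}" "irr (y # nf f)" using irr_Cons_exists irr_nf by blast
    show thesis
    proof (rule that[OF y(1)])
      fix t' f' x' y'
      assume A: "t' \<in> T" "f' \<in> F" "x' \<in> {1, 2}" "y' \<in> {1, 2}"
        "nf (t @ [x, x, y, y, y] @ f) = nf (t' @ [x', x', y', y', y'] @ f')"
      have nz: "x \<noteq> 0" "y \<noteq> 0" "x' \<noteq> 0" "y' \<noteq> 0" using x y A by auto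
      show "nf t = nf t' \<and> x = x' \<and> y = y' \<and> nf f = nf f'"
        using t(2)[OF A(1)] f(2)[OF A(2)] deg_nf[OF tf(1)] deg_nf[OF A(1)]
        by (intro unique_product_acyclic[OF acyclic irr_nf irr_nf x(2) y(2) irr_nf irr_nf
            _ _ _ nz eq'[OF A(5)]]) simp_all
    qed
  next
    case False
    then obtain a c where cyc: "a # c \<in> W" "c @ [a] \<in> W" by blast
    have "irr (dropWhile (\<lambda>a. a = 0) (nf f))"
      using irr_factor[of "takeWhile (\<lambda>a. a = 0) (nf f)" "dropWhile (\<lambda>a. a = 0) (nf f)" "[]"]
        irr_nf[of f] by simp
    moreover have "0 \<notin> set (dropWhile (\<lambda>a. a = 0) (nf f))"
      using cyclic_irr_split[OF cyc irr_nf set_nf] tf by blast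
    ultimately obtain y where y: "y \<in> {1, 2}" "irr (y # dropWhile (\<lambda>a. a = 0) (nf f))"
      using irr_Cons_exists by blast
    show thesis
    proof (rule that[OF y(1)])
      fix t' f' x' y'
      assume A: "t' \<in> T" "f' \<in> F" "x' \<in> {1, 2}" "y' \<in> {1, 2}"
        "nf (t @ [x, x, y, y, y] @ f) = nf (t' @ [x', x', y', y', y'] @ f')"
      have nz: "x \<in> {1..n}" "y \<in> {1..n}" "x' \<in> {1..n}" "y' \<in> {1..n}"
        using x y A three_le by auto
      have sets: "set (nf t) \<subseteq> {0..n}" "set (nf f) \<subseteq> {0..n}"
        "set (nf t') \<subseteq> {0..n}" "set (nf f') \<subseteq> {0..n}"
        using set_nf tf A by auto
      show "nf t = nf t' \<and> x = x' \<and> y = y' \<and> nf f = nf f'"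
        using t(2)[OF A(1)] f(2)[OF A(2)] deg_nf[OF tf(1)] deg_nf[OF A(1)]
        by (intro unique_product_cyclic[OF cyc irr_nf irr_nf x(2) y(2) irr_nf irr_nf sets
            _ _ _ nz eq'[OF A(5)]]) simp_all
    qed
  qed
  have sep: "[x, x, y, y, y] \<in> separators" using x(1) y by (auto simp: separators_def)
  show ?thesis
  proof (rule bexI[OF _ tf(1)], rule bexI[OF _ sep], rule bexI[OF _ tf(2)], intro ballI impI)
    fix t' q' f'
    assume A: "t' \<in> T" "q' \<in> separators" "f' \<in> F"
      and eq: "nf (t @ [x, x, y, y, y] @ f) = nf (t' @ q' @ f')"
    from A(2) obtain x' y' where q': "q' = [x', x', y', y', y']" "x' \<in> {1, 2}" "y' \<in> {1, 2}"
      unfolding separators_def by auto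
    then show "nf t' = nf t \<and> q' = [x, x, y, y, y] \<and> nf f' = nf f"
      using unique[OF A(1,3) q'(2,3)] eq by simp
  qed
qed

end

section \<open>Regular abelian permutation groups\<close>

locale regular_abelian_perms =
  fixes n :: nat and H :: "(nat \<Rightarrow> nat) set"
  assumes three_le_n: "3 \<le> n"
    and perm: "s \<in> H \<Longrightarrow> s permutes {1..n}"
    and comm: "s \<in> H \<Longrightarrow> t \<in> H \<Longrightarrow> s (t i) = t (s i)"
    and comp: "s \<in> H \<Longrightarrow> t \<in> H \<Longrightarrow> s \<circ> t \<in> H"
    and id: "id \<in> H"
    and transitive: "x \<in> {1..n} \<Longrightarrow> y \<in> {1..n} \<Longrightarrow> \<exists>s\<in>H. s x = y"
begin

text \<open>An element \<open>g\<close> carrying \<open>i\<close> to \<open>x\<close> commutes with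
  \<open>s\<close> and \<open>t\<close>, so agreement at \<open>i\<close> spreads to the whole
  orbit; outside \<open>{1..n}\<close> both are the identity.\<close>

lemma regular:
  assumes "s \<in> H" "t \<in> H" "i \<in> {1..n}" "s i = t i"
  shows "s = t"
proof
  fix x
  show "s x = t x"
  proof (cases "x \<in> {1..n}")
    case True
    obtain g where g: "g \<in> H" "g i = x" using transitive assms(3) True by blast
    have "s (g i) = t (g i)" using comm[OF assms(1) g(1)] comm[OF assms(2) g(1)] assms(4) by simp
    then show ?thesis using g by simp
  next
    case False
    then show ?thesis using permutes_not_in[OF perm] assms by metis
  qed
qed

definition relator :: "(nat \<Rightarrow> nat) \<Rightarrow> nat list" where
  "relator s = map s (base_word n)"

lemma nth_relator: "i < n \<Longrightarrow> relator s ! i = s (Suc i)"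
  by (simp add: relator_def length_base_word nth_base_word)

lemma length_relator: "length (relator s) = n"
  by (simp add: relator_def length_base_word)

lemma nth_relator_append:
  assumes "relator s = p @ c @ r" "i < length c"
  shows "c ! i = s (Suc (length p + i))"
proof -
  have "length p + i < n" using assms length_relator[of s] by simp
  moreover have "relator s ! (length p + i) = c ! i" using assms by (simp add: nth_append)
  ultimately show ?thesis using nth_relator by metis
qed

text \<open>By regularity the overlaps read t = sh, s' = sk and t'k = s'h, where \<open>h\<close>
  and \<open>k\<close> send 1 to the positions at which \<open>c\<close> and \<open>u\<close> start
  in \<open>relator s\<close>. Commutativity gives \<open>t' = t\<close>, so \<open>c\<close> and
  \<open>c'\<close> are prefixes of one relator, and \<open>c\<close> is not the longer.\<close>

lemma relator_shift_prefix:
  assumes "a @ u @ c = relator s" "c @ v = relator t" "u @ c' = relator s'" "c' @ v' = relator t'"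
    and "s \<in> H" "t \<in> H" "s' \<in> H" "t' \<in> H" and ne: "u \<noteq> []" "c \<noteq> []"
  shows "\<exists>m. c' = c @ m"
proof -
  have len: "length a + length u + length c = n" "length u + length c' = n"
    using length_relator[of s] length_relator[of s'] assms(1,3)[symmetric] by simp_all
  have pos: "0 < length u" "0 < length c" using ne by auto
  let ?l = "length a + length u"
  have *: "t 1 = s (Suc ?l)"
    using nth_relator_append[of s "a @ u" c "[]" 0] nth_relator_append[of t "[]" c v 0] assms(1,2) pos
    by simp
  have **: "s (Suc (length a)) = s' 1"
    using nth_relator_append[of s a u c 0] nth_relator_append[of s' "[]" u c' 0] assms(1,3) pos
    by simp
  \<comment> \<open>The index \<open>length a\<close> is valid in \<open>c'\<close> because
    \<open>c\<close> is nonempty.\<close>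
  have ***: "t' (Suc (length a)) = s' (Suc ?l)"
    using nth_relator_append[of s' u c' "[]" "length a"]
      nth_relator_append[of t' "[]" c' v' "length a"] assms(3,4) len pos
    by (simp add: add.commute)
  obtain h where h: "h \<in> H" "h 1 = Suc ?l" using transitive[of 1 "Suc ?l"] len pos by auto
  obtain k where k: "k \<in> H" "k 1 = Suc (length a)"
    using transitive[of 1 "Suc (length a)"] len pos by auto
  have "t' (Suc (length a)) = h (s (k 1))"
    using *** ** h k comm[OF assms(7) h(1), of 1] by simp
  also have "\<dots> = k (s (h 1))"
    using comm[OF assms(5) k(1), of 1] comm[OF h(1) k(1)] comm[OF assms(5) h(1), of 1] by simp
  also have "\<dots> = t (Suc (length a))"
    using * h k comm[OF assms(6) k(1), of 1] by simp
  finally have "t' = t"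
    using regular[OF assms(8,6), of "Suc (length a)"] len pos by simp
  then have "c' @ v' = c @ v" using assms(2,4) by simp
  moreover have "length c \<le> length c'" using len by simp
  ultimately show ?thesis by (auto simp: append_eq_append_conv2)
qed

sublocale relator_words "relator ` H" n
proof (unfold_locales, goal_cases)
  case 1
  then show ?case by (rule three_le_n)
next
  case (2 w)
  then show ?case by (auto simp: length_relator)
next
  case (3 w)
  then obtain s where "s \<in> H" "w = relator s" by blast
  then show ?case
    by (simp add: relator_def distinct_map distinct_base_word permutes_inj_on[OF perm])
next
  case (4 w)
  then obtain s where "s \<in> H" "w = relator s" by blast
  then show ?case by (simp only: relator_def set_map set_base_word permutes_image[OF perm])
next
  case (5 w w' i)
  then obtain s s' where s: "s \<in> H" "s' \<in> H" "w = relator s" "w' = relator s'" by blast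
  have "s (Suc i) = s' (Suc i)" using 5(3,4) nth_relator[OF 5(3)] s by simp
  then have "s = s'" using 5(3) by (intro regular[OF s(1,2), of "Suc i"]) auto
  then show ?case using s by simp
next
  case (6 a u c v c' v')
  obtain s where s: "a @ u @ c = relator s" "s \<in> H" using 6(1) by blast
  obtain t where t: "c @ v = relator t" "t \<in> H" using 6(2) by blast
  obtain s' where s': "u @ c' = relator s'" "s' \<in> H" using 6(3) by blast
  obtain t' where t': "c' @ v' = relator t'" "t' \<in> H" using 6(4) by blast
  show ?case by (rule relator_shift_prefix[OF s(1) t(1) s'(1) t'(1) s(2) t(2) s'(2) t'(2) 6(6,7)])
next
  case (7 x c y)
  then obtain s t where st: "s \<in> H" "t \<in> H" "x # c = relator s" "c @ [x] = relator t" by blast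
  have "set (relator s) = {1..n}"
    by (simp only: relator_def set_map set_base_word permutes_image[OF perm[OF st(1)]])
  then have "x \<in> {1..n}" using st(3)[symmetric] by auto
  then obtain g where g: "g \<in> H" "g x = y" using transitive 7(3) by blast
  \<comment> \<open>Composing with \<open>g\<close> renames letters, so the rotation at
    \<open>x\<close> becomes one at \<open>g x = y\<close>.\<close>
  have "relator (g \<circ> s) = map g (relator s)" "relator (g \<circ> t) = map g (relator t)"
    by (simp_all add: relator_def)
  then have "relator (g \<circ> s) = y # map g c" "relator (g \<circ> t) = map g c @ [y]"
    using g(2) by (simp_all flip: st(3,4))
  moreover have "relator (g \<circ> s) \<in> relator ` H" "relator (g \<circ> t) \<in> relator ` H"
    using comp[OF g(1)] st by blast+
  ultimately show ?case by auto
qed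

section \<open>Normal forms decide equality in the monoid\<close>

lemma base_word_relator: "base_word n \<in> relator ` H"
proof (rule image_eqI[OF _ id])
  show "base_word n = relator id" by (simp add: relator_def)
qed

lemma sn_eq_relator: "w \<in> relator ` H \<Longrightarrow> sn_eq n H (base_word n) w"
  using sn_eq.rel[of _ H n "[]" "[]"] by (auto simp: relator_def)

lemma sn_eq_imp_nf_eq: "sn_eq n H u v \<Longrightarrow> nf u = nf v"
proof (induction rule: sn_eq.induct)
  case (rel s u v)
  have "relator s \<in> relator ` H" using rel by blast
  then show ?case
    using nf_eqI[OF rule_steps[OF contract[OF base_word_relator]], of u v]
      nf_eqI[OF rule_steps[OF contract], of "relator s" u v]
    by (simp add: relator_def)
qed auto

text \<open>Interprets z by the base word; another relator would give a congruent word. It carries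
  reductions back to \<open>sn_eq\<close>.\<close>

definition expand :: "nat list \<Rightarrow> nat list" where
  "expand w = concat (map (\<lambda>a. if a = 0 then base_word n else [a]) w)"

lemma expand_simps [simp]: "expand [] = []" "expand (a # w) = (if a = 0 then base_word n else [a]) @ expand w"
  "expand (u @ v) = expand u @ expand v"
  by (simp_all add: expand_def)

lemma expand_nonzero: "0 \<notin> set w \<Longrightarrow> expand w = w"
  by (induction w) auto

text \<open>For \<open>move\<close>, both sides are congruent to \<open>u @ c @ v\<close>, read once
  as \<open>u\<close> times a relator and once as a relator times \<open>v\<close>.\<close>

lemma rule_sn_eq: "rule l r \<Longrightarrow> sn_eq n H (expand l) (expand r)"
proof (induction rule: rule.induct)
  case (contract w)
  then show ?case
    using sn_eq.sym[OF sn_eq_relator] expand_nonzero[OF zero_notin_W] by simp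
next
  case (move u c v)
  have "sn_eq n H (u @ base_word n) (u @ c @ v)"
    using sn_eq_append_context[OF sn_eq_relator[OF move(2)], of u "[]"] by simp
  moreover have "sn_eq n H (u @ c @ v) (base_word n @ v)"
    using sn_eq_append_context[OF sn_eq.sym[OF sn_eq_relator[OF move(1)]], of "[]" v] by simp
  ultimately have "sn_eq n H (u @ base_word n) (base_word n @ v)" by (rule sn_eq.trans)
  then show ?case
    using zero_notin_W[OF move(1)] zero_notin_W[OF move(2)] by (simp add: expand_nonzero)
qed

lemma steps_sn_eq: "steps u v \<Longrightarrow> sn_eq n H (expand u) (expand v)"
proof (induction rule: rtranclp_induct)
  case base
  then show ?case by (rule sn_eq.refl)
next
  case (step v w)
  then obtain p l r s where "rule l r" "v = p @ l @ s" "w = p @ r @ s"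
    by (auto elim!: step.cases)
  then have "sn_eq n H (expand v) (expand w)"
    using sn_eq_append_context[OF rule_sn_eq, of l r "expand p" "expand s"] by simp
  then show ?case using step.IH sn_eq.trans by blast
qed

lemma nf_eq_imp_sn_eq:
  assumes "nf u = nf v" "0 \<notin> set u" "0 \<notin> set v"
  shows "sn_eq n H u v"
proof -
  have "sn_eq n H u (expand (nf u))" "sn_eq n H v (expand (nf u))"
    using steps_sn_eq[OF steps_nf[of u]] steps_sn_eq[OF steps_nf[of v]] assms
    by (simp_all add: expand_nonzero)
  then show ?thesis using sn_eq.sym sn_eq.trans by blast
qed

lemma jacobson_radical_sn_algebra_regular:
  "jacobson_radical (sn_algebra n H :: (nat list set \<Rightarrow> 'k::field) ring)
    = {\<zero>\<^bsub>sn_algebra n H :: (nat list set \<Rightarrow> 'k) ring\<^esub>}"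
proof (rule jacobson_radical_sn_algebra_eq_zero[of separators n 5])
  show "finite separators" by (simp add: separators_def)
  show "set q \<subseteq> {1..n} \<and> length q = 5" if "q \<in> separators" for q
    using that three_le_n by (auto simp: separators_def)
  fix T F :: "nat list set" and i j
  assume T: "finite T" "T \<noteq> {}" "\<forall>t\<in>T. set t \<subseteq> {1..n} \<and> length t = i"
    and F: "finite F" "F \<noteq> {}" "\<forall>f\<in>F. set f \<subseteq> {1..n} \<and> length f = j"
  obtain t q f where tqf: "t \<in> T" "q \<in> separators" "f \<in> F"
    and uniq: "\<forall>t'\<in>T. \<forall>q'\<in>separators. \<forall>f'\<in>F.
      nf (t @ q @ f) = nf (t' @ q' @ f') \<longrightarrow> nf t' = nf t \<and> q' = q \<and> nf f' = nf f"
    using unique_product[OF T F] by (elim bexE)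
  have nz: "0 \<notin> set w" if "w \<in> T \<union> F" for w using that T F by fastforce
  have "sn_eq n H t' t \<and> q' = q \<and> sn_eq n H f' f"
    if A: "t' \<in> T" "q' \<in> separators" "f' \<in> F" and eq: "sn_eq n H (t @ q @ f) (t' @ q' @ f')"
    for t' q' f'
  proof -
    have "nf t' = nf t" "q' = q" "nf f' = nf f"
      using uniq A sn_eq_imp_nf_eq[OF eq] by blast+
    then show ?thesis using nf_eq_imp_sn_eq nz tqf A by blast
  qed
  then show "\<exists>t\<in>T. \<exists>q\<in>separators. \<exists>f\<in>F. \<forall>t'\<in>T. \<forall>q'\<in>separators. \<forall>f'\<in>F.
      sn_eq n H (t @ q @ f) (t' @ q' @ f') \<longrightarrow> sn_eq n H t' t \<and> q' = q \<and> sn_eq n H f' f"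
    using tqf by blast
qed simp

end

theorem theorem4p9:
  fixes n :: nat and H :: "(nat \<Rightarrow> nat) set"
  assumes "n \<ge> 1"
    and "subgroup H (sym_group n)"
    and "\<forall>s\<in>H. \<forall>t\<in>H. s \<circ> t = t \<circ> s"
  shows "jacobson_radical (sn_algebra n H :: (nat list set \<Rightarrow> 'k::field) ring)
           = {\<zero>\<^bsub>sn_algebra n H :: (nat list set \<Rightarrow> 'k::field) ring\<^esub>}"
proof -
  have perm: "s permutes {1..n}" if "s \<in> H" for s
    using subgroup.subset[OF assms(2)] that by (auto simp: sym_group_def)
  have comp: "s \<circ> t \<in> H" if "s \<in> H" "t \<in> H" for s t
    using subgroup.m_closed[OF assms(2) that] by (simp add: sym_group_def)
  have id: "id \<in> H" using subgroup.one_closed[OF assms(2)] by (simp add: sym_group_def)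
  have inv: "\<exists>t\<in>H. \<forall>i. t (s i) = i" if "s \<in> H" for s
  proof -
    have "s \<in> carrier (sym_group n)" using perm[OF that] by (simp add: sym_group_def)
    then have "(inv\<^bsub>sym_group n\<^esub> s) \<otimes>\<^bsub>sym_group n\<^esub> s = \<one>\<^bsub>sym_group n\<^esub>"
      by (rule group.l_inv[OF sym_group_is_group])
    then have "(inv\<^bsub>sym_group n\<^esub> s) \<circ> s = id" by (simp add: sym_group_def)
    then have "\<forall>i. (inv\<^bsub>sym_group n\<^esub> s) (s i) = i" by (metis comp_apply id_apply)
    then show ?thesis using subgroup.m_inv_closed[OF assms(2) that] by blast
  qed
  have comm: "s (t i) = t (s i)" if "s \<in> H" "t \<in> H" for s t i
    using assms(3) that by (metis comp_apply)
  \<comment> \<open>The first alternative absorbs n = 1 and, for n = 2, the trivial group.\<close>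
  consider "\<forall>s\<in>H. map s (base_word n) = base_word n"
    | s where "s \<in> H" "map s (base_word n) \<noteq> base_word n" "n = 2"
    | "n \<ge> 3"
  proof -
    have "map s (base_word n) = base_word n" if "n = 1" "s \<in> H" for s
      using perm[OF that(2)] permutes_in_image[of s "{1..n}" 1] that(1) by (auto simp: base_word_def)
    then show thesis using that assms(1) by (cases "n = 1"; cases "n = 2") force+
  qed
  then show ?thesis
  proof cases
    case 1
    then show ?thesis using jacobson_radical_sn_algebra_trivial assms(1) by blast
  next
    case (2 s)
    have "base_word n = [1, 2]" using 2(3) by (simp add: base_word_def upt_rec)
    moreover have "s 1 \<in> {1, 2}" "s 2 \<in> {1, 2}" "s 1 \<noteq> s 2"
    proof -
      have "{1..n} = {1, 2}" using 2(3) by auto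
      then show "s 1 \<in> {1, 2}" "s 2 \<in> {1, 2}"
        using permutes_in_image[OF perm[OF 2(1)], of 1] permutes_in_image[OF perm[OF 2(1)], of 2] by auto
      show "s 1 \<noteq> s 2" using injD[OF permutes_inj[OF perm[OF 2(1)]], of 1 2] by auto
    qed
    ultimately have "s 1 = 2" "s 2 = 1" using 2(2) by auto
    then show ?thesis using jacobson_radical_sn_algebra_swap[of s H] perm 2(1,3) by blast
  next
    case 3
    show ?thesis
    proof (cases "\<forall>x\<in>{1..n}. \<exists>s\<in>H. s 1 = x")
      case orbit: True
      have "\<exists>s\<in>H. s x = y" if "x \<in> {1..n}" "y \<in> {1..n}" for x y
      proof -
        obtain s t where st: "s \<in> H" "s 1 = x" "t \<in> H" "t 1 = y" using orbit \<open>x \<in> _\<close> \<open>y \<in> _\<close> by blast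
        obtain r where "r \<in> H" "\<forall>i. r (s i) = i" using inv[OF st(1)] by blast
        then have "(t \<circ> r) x = y" using st by auto
        then show ?thesis using comp[OF st(3) \<open>r \<in> H\<close>] by blast
      qed
      then interpret regular_abelian_perms n H
        using 3 perm comp id comm by unfold_locales auto
      show ?thesis by (rule jacobson_radical_sn_algebra_regular)
    next
      case False
      then obtain x where x: "x \<in> {1..n}" "\<And>s. s \<in> H \<Longrightarrow> s 1 \<noteq> x" by blast
      \<comment> \<open>If \<open>n\<close> could be sent to every letter, then to 1 and to
        \<open>x\<close>, and \<open>x\<close> would lie in the orbit of 1.\<close>
      have "\<exists>y\<in>{1..n}. \<forall>s\<in>H. s n \<noteq> y"
      proof (rule ccontr)
        assume "\<not> ?thesis"
        then have ex: "\<exists>s\<in>H. s n = y" if "y \<in> {1..n}" for y using that by blast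
        obtain s where s: "s \<in> H" "s n = 1" using ex[of 1] assms(1) by auto
        obtain t where t: "t \<in> H" "t n = x" using ex[OF x(1)] by blast
        obtain r where r: "r \<in> H" "\<forall>i. r (s i) = i" using inv[OF s(1)] by blast
        have "(t \<circ> r) 1 = x" using r(2) s t by (metis comp_apply)
        then show False using x(2)[OF comp[OF t(1) r(1)]] by simp
      qed
      then obtain y where "y \<in> {1..n}" "\<And>s. s \<in> H \<Longrightarrow> s n \<noteq> y" by blast
      then show ?thesis
        using x perm id 3 by (intro jacobson_radical_sn_algebra_non_transitive[of H n x y]) auto
    qed
  qed
qed

end
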